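(* Let $R$ be a random variable with values in $\{1,2,\dots\}$ such that $\mathbb{E}[R^{1+\varepsilon}]<\infty$ for some $\varepsilon>0$, and set $\mu=\mathbb{E}[R]$. Let $T_n$ be the continuous cover time of $\mathbb{Z}/n\mathbb{Z}$ for the covering process with radius distribution $R$. Then, as $n\to\infty$, $$\frac{\mu}{n}T_n-\ln n\ \Longrightarrow\ \mathrm{Gumbel}(0,1)$$ in distribution.
   Context: Covering process: let $R$ be a random variable with values in $\{1,2,\dots\}$ and $f(r)=\mathbb{P}(R\ge r)$ for real $r\ge 1$ (so $f(1)=1$). For $n\ge1$ consider the discrete torus $\mathbb{Z}/n\mathbb{Z}=\{0,\dots,n-1\}$. Let $(R_k)_{k\ge1}$ be i.i.d. copies of $R$ and $(U_k)_{k\ge1}$ i.i.d. uniform on $\mathbb{Z}/n\mathbb{Z}$, independent of each other. The $k$-th object is the arc $\mathcal{O}_k=\{U_k,U_k+1,\dots,U_k+R_k-1\}\subset\mathbb{Z}/n\mathbb{Z}$ (addition mod $n$). Set $C_0=\emptyset$, $C_k=C_{k-1}\cup\mathcal{O}_k$. Let $(N(t))_{t\ge0}$ be a rate-one Poisson process independent of everything, and define the continuous-time covering process $X_t=C_{N(t)}$ and the continuous cover time $T_n=\inf\{t: X_t=\mathbb{Z}/n\mathbb{Z}\}$. $\mathrm{Gumbel}(0,1)$ denotes the law with $\mathbb{P}(G<t)=\exp(-e^{-t})$. *)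

theory Defs
  imports "HOL-Probability.Probability"
begin

text \<open>Sample points: a sequence indexed by k (objects numbered 0,1,2,...), where
  the k-th coordinate is ((R_k, U_k), E_k): radius R_k, left end U_k in Z/nZ = {0..<n},
  and E_k the k-th exponential(1) inter-arrival time of the rate-one Poisson process.\<close>

type_synonym sample = "nat \<Rightarrow> (nat \<times> nat) \<times> real"

definition coord_measure :: "nat pmf \<Rightarrow> nat \<Rightarrow> ((nat \<times> nat) \<times> real) measure" where
  "coord_measure pR n =
     (measure_pmf pR \<Otimes>\<^sub>M measure_pmf (pmf_of_set {0..<n})) \<Otimes>\<^sub>M density lborel (exponential_density 1)"

definition cover_space :: "nat pmf \<Rightarrow> nat \<Rightarrow> sample measure" where
  "cover_space pR n = (\<Pi>\<^sub>M k\<in>(UNIV::nat set). coord_measure pR n)"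

definition arc :: "nat \<Rightarrow> nat \<Rightarrow> nat \<Rightarrow> nat set" where
  "arc n u r = {(u + i) mod n | i. i < r}"

definition obj :: "nat \<Rightarrow> sample \<Rightarrow> nat \<Rightarrow> nat set" where
  "obj n \<omega> k = arc n (snd (fst (\<omega> k))) (fst (fst (\<omega> k)))"

definition covered :: "nat \<Rightarrow> sample \<Rightarrow> nat \<Rightarrow> nat set" where
  "covered n \<omega> m = (\<Union>k<m. obj n \<omega> k)"

definition arrival :: "sample \<Rightarrow> nat \<Rightarrow> real" where
  "arrival \<omega> k = (\<Sum>i\<le>k. snd (\<omega> i))"

definition poisson_count :: "sample \<Rightarrow> real \<Rightarrow> nat" where
  "poisson_count \<omega> t = card {k. arrival \<omega> k \<le> t}"

definition cover_proc :: "nat \<Rightarrow> sample \<Rightarrow> real \<Rightarrow> nat set" where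
  "cover_proc n \<omega> t = covered n \<omega> (poisson_count \<omega> t)"

definition cover_time :: "nat \<Rightarrow> sample \<Rightarrow> real" where
  "cover_time n \<omega> = Inf {t. 0 \<le> t \<and> cover_proc n \<omega> t = {0..<n}}"

end

theory Submission
  imports Defs "HOL-Computational_Algebra.Formal_Power_Series" "HOL-Real_Asymp.Real_Asymp"
begin

text \<open>A set \<open>A\<close> of sites is missed up to time \<open>t\<close> with probability \<open>exp (- t/n E hit)\<close>, where the expected
  number of starting points whose arc hits \<open>A\<close> is the sum of \<open>E min(R, g)\<close> over the cyclic gaps \<open>g\<close> of \<open>A\<close>. Inclusion-exclusion
  over \<open>A\<close> therefore has renewal structure and gives the exact formula
  \<open>P(T_n \<le> t) = 1 - [X^n] (X G'/G)\<close> with \<open>G = 1 + (\<Sum>g\<ge>1. exp(-(t/n) E min(R, g)) X^g)\<close>.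
  For \<open>t = n (ln n + x) / \<mu>\<close> the coefficients of \<open>G\<close> tend to \<open>w = exp(-x)/n\<close>, and replacing all of them by \<open>w\<close>
  turns the right-hand side into \<open>(1 - w)^n\<close>, which tends to the Gumbel distribution function. The moment
  assumption bounds the deviations of the coefficients at large gaps; at small gaps \<open>R \<ge> 1\<close> suffices.\<close>

unbundle no vec_syntax
unbundle fps_syntax

section \<open>Logarithmic derivatives of perturbed power series\<close>

text \<open>The inclusion-exclusion sum has \<open>2^n\<close> alternating terms, too many for
  termwise estimates, so it is kept exact. Poissonization makes this possible: the exponent is
  additive over gaps, so each term is a product over gaps. A non-empty \<open>A\<close> is cut open
  at the gap that wraps around 0. The inner gaps give the recursion of \<open>1/G\<close>; a
  wrapping gap of length \<open>g\<close> has \<open>g\<close> possible positions, which turns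
  \<open>G\<close> into \<open>X G'\<close>. The comparison with the constant-weight series
  \<open>F\<close> is multiplicative, since logarithmic derivatives then add and only
  \<open>1/F\<close>, of l1-norm at most 2, enters the error. The derivative weights the deviation
  at gap \<open>g\<close> by \<open>g\<close>, so besides the sum of the deviations also
  \<open>g\<close> times each single one must be small. Both follow by splitting at
  \<open>g = n^(1/(2 \<mu>))\<close>: below, the deviation is at most \<open>exp (- l)\<close>, of
  order \<open>n^(-1/\<mu>)\<close>; above, it is a vanishing fraction of \<open>w\<close>, and
  \<open>n w = exp (- x)\<close> stays bounded.\<close>

definition fps_norm1 :: "nat \<Rightarrow> real fps \<Rightarrow> real" where
  "fps_norm1 n A = (\<Sum>i\<le>n. \<bar>A $ i\<bar>)"

lemma fps_norm1_nonneg: "0 \<le> fps_norm1 n A"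
  by (simp add: fps_norm1_def sum_nonneg)

lemma fps_norm1_add: "fps_norm1 n (A + B) \<le> fps_norm1 n A + fps_norm1 n B"
  unfolding fps_norm1_def sum.distrib[symmetric] by (rule sum_mono) auto

text \<open>Coefficients of a product up to \<open>n\<close> involve only coefficients up to
  \<open>n\<close> of the factors, so the truncated norm is submultiplicative while being finite for
  every series.\<close>

lemma fps_norm1_mult: "fps_norm1 n (A * B) \<le> fps_norm1 n A * fps_norm1 n B"
proof -
  have "fps_norm1 n (A * B) \<le> (\<Sum>i\<le>n. \<Sum>j\<le>i. \<bar>A $ j\<bar> * \<bar>B $ (i - j)\<bar>)"
    unfolding fps_norm1_def fps_mult_nth abs_mult[symmetric] atMost_atLeast0
    by (intro sum_mono sum_abs)
  also have "\<dots> = (\<Sum>(j, l)\<in>{(j, l). j + l \<le> n}. \<bar>A $ j\<bar> * \<bar>B $ l\<bar>)"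
    by (rule sum.triangle_reindex_eq[symmetric])
  also have "\<dots> \<le> (\<Sum>(j, l)\<in>{..n} \<times> {..n}. \<bar>A $ j\<bar> * \<bar>B $ l\<bar>)"
    by (rule sum_mono2) auto
  also have "\<dots> = fps_norm1 n A * fps_norm1 n B"
    by (simp add: fps_norm1_def sum_product sum.cartesian_product)
  finally show ?thesis .
qed

text \<open>\<open>V = 1 - E V\<close> gives norm \<open>V\<close> at most 1 plus half of norm
  \<open>V\<close>; the truncated norm is finite, so that half can be absorbed on the left.\<close>

lemma fps_norm1_inverse_le:
  assumes "E $ 0 = 0" "fps_norm1 n E \<le> 1 / 2"
  shows "fps_norm1 n (inverse (1 + E)) \<le> 2"
proof -
  let ?V = "inverse (1 + E)"
  have "(1 + E) * ?V = 1"
    using assms(1) by (intro inverse_mult_eq_1') simp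
  then have "?V = 1 + - E * ?V"
    by (simp add: algebra_simps)
  then have "fps_norm1 n ?V \<le> fps_norm1 n 1 + fps_norm1 n (- E) * fps_norm1 n ?V"
    using fps_norm1_add[of n 1 "- E * ?V"] fps_norm1_mult[of n "- E" ?V] by simp
  also have "fps_norm1 n 1 = 1"
  proof -
    have "fps_norm1 n 1 = (\<Sum>i\<le>n. if i = 0 then 1 else 0)"
      unfolding fps_norm1_def by (rule sum.cong) auto
    then show ?thesis by (simp add: sum.delta)
  qed
  also have "fps_norm1 n (- E) * fps_norm1 n ?V \<le> 1 / 2 * fps_norm1 n ?V"
    using assms(2) fps_norm1_nonneg by (intro mult_right_mono) (auto simp: fps_norm1_def)
  finally show ?thesis by simp
qed

section \<open>The model series with constant weight \<open>w\<close> at every positive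
  index\<close>

context
  fixes w :: real
begin

definition step_fps :: "real fps" where
  "step_fps = Abs_fps (\<lambda>g. if g = 0 then 1 else w)"

text \<open>Expansion of \<open>(1 - X) / (1 - (1 - w) X)\<close>.\<close>

definition step_inv_fps :: "real fps" where
  "step_inv_fps = Abs_fps (\<lambda>j. if j = 0 then 1 else - w * (1 - w) ^ (j - 1))"

lemma step_fps_eq: "(1 - fps_X) * step_fps = 1 - fps_const (1 - w) * fps_X"
proof (rule fps_ext)
  fix m
  show "((1 - fps_X) * step_fps) $ m = (1 - fps_const (1 - w) * fps_X) $ m"
    by (cases "m = 0"; cases "m = 1") (auto simp: step_fps_def left_diff_distrib fps_X_nth)
qed

lemma step_inv_fps_eq: "(1 - fps_const (1 - w) * fps_X) * step_inv_fps = 1 - fps_X"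
proof (rule fps_ext)
  fix m
  have *: "(fps_const (1 - w) * fps_X) * A = fps_const (1 - w) * (fps_X * A)" for A :: "real fps"
    by (simp add: mult.assoc)
  have "m = 0 \<or> m = 1 \<or> (\<exists>k. m = Suc (Suc k))"
    by (cases m) (auto, metis not0_implies_Suc)
  then show "((1 - fps_const (1 - w) * fps_X) * step_inv_fps) $ m = (1 - fps_X :: real fps) $ m"
    unfolding left_diff_distrib * by (auto simp: step_inv_fps_def fps_X_nth algebra_simps)
qed

lemma fps_linear_nonzero: "(1 - fps_const c * fps_X :: real fps) \<noteq> 0" "(1 - fps_X :: real fps) \<noteq> 0"
proof -
  have "(1 - fps_const c * fps_X :: real fps) $ 0 \<noteq> 0 $ 0" "(1 - fps_X :: real fps) $ 0 \<noteq> 0 $ 0"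
    by simp_all
  then show "(1 - fps_const c * fps_X :: real fps) \<noteq> 0" "(1 - fps_X :: real fps) \<noteq> 0"
    by metis+
qed

lemma step_fps_mult_inv: "step_fps * step_inv_fps = 1"
proof -
  let ?l = "1 - fps_X :: real fps" and ?r = "1 - fps_const (1 - w) * fps_X"
  have "?l * ?r * (step_fps * step_inv_fps) = (?l * step_fps) * (?r * step_inv_fps)"
    by (simp only: ac_simps)
  also have "\<dots> = ?l * ?r * 1"
    unfolding step_fps_eq step_inv_fps_eq by (simp only: ac_simps mult_1)
  finally show ?thesis
    using fps_linear_nonzero by (metis mult_cancel_left mult_eq_0_iff)
qed

text \<open>With \<open>q = 1 - w\<close>, the series is \<open>F = (1 - q X) / (1 - X)\<close>,
  hence \<open>X F'/F = 1/(1 - X) - 1/(1 - q X)\<close>. The proof multiplies by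
  \<open>(1 - X) (1 - q X)\<close>, after which both sides equal \<open>w X\<close>.\<close>

lemma step_fps_log_deriv:
  "fps_X * fps_deriv step_fps * step_inv_fps = Abs_fps (\<lambda>n. 1 - (1 - w) ^ n)" (is "?L = ?P")
proof -
  let ?l = "1 - fps_X :: real fps" and ?r = "1 - fps_const (1 - w) * fps_X"
  have "fps_deriv (?l * step_fps) = fps_deriv ?r"
    by (simp only: step_fps_eq)
  then have 1: "?l * fps_deriv step_fps = step_fps - fps_const (1 - w)"
    by (simp add: algebra_simps flip: fps_const_sub)
  have "?l * ?r * ?L = fps_X * (?l * fps_deriv step_fps) * (?r * step_inv_fps)"
    by (simp only: ac_simps)
  also have "\<dots> = fps_X * (?l * step_fps - ?l * fps_const (1 - w))"
    unfolding 1 step_inv_fps_eq by (simp add: algebra_simps)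
  also have "\<dots> = fps_const w * fps_X"
    unfolding step_fps_eq by (simp add: algebra_simps flip: fps_const_sub)
  also have "\<dots> = ?l * ?r * ?P"
  proof -
    have diff_split: "l * r * (A - B) = r * (l * A) - l * (r * B)" for l r A B :: "real fps"
      by (simp add: algebra_simps)
    have a: "?l * Abs_fps (\<lambda>n. 1) = 1"
    proof (rule fps_ext)
      fix m show "(?l * Abs_fps (\<lambda>n. 1)) $ m = 1 $ m"
        by (cases m) (auto simp: algebra_simps)
    qed
    have b: "?r * Abs_fps (\<lambda>n. (1 - w) ^ n) = 1"
    proof (rule fps_ext)
      fix m show "(?r * Abs_fps (\<lambda>n. (1 - w) ^ n)) $ m = 1 $ m"
        by (cases m) (auto simp: left_diff_distrib mult.assoc)
    qed
    have "?P = Abs_fps (\<lambda>n. 1) - Abs_fps (\<lambda>n. (1 - w) ^ n)"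
      by (rule fps_ext) simp
    then have "?l * ?r * ?P = ?r * (?l * Abs_fps (\<lambda>n. 1)) - ?l * (?r * Abs_fps (\<lambda>n. (1 - w) ^ n))"
      by (simp only: diff_split)
    also have "\<dots> = fps_const w * fps_X"
      unfolding a b by (simp add: algebra_simps flip: fps_const_sub)
    finally show ?thesis by simp
  qed
  finally show ?thesis
    using fps_linear_nonzero by (metis mult_cancel_left mult_eq_0_iff)
qed

text \<open>The tail is a telescoping geometric sum below 1, so the bound is uniform in
  \<open>n\<close> and does not deteriorate as \<open>w\<close> tends to 0.\<close>

lemma fps_norm1_step_inv_le:
  assumes "0 \<le> w" "w \<le> 1"
  shows "fps_norm1 n step_inv_fps \<le> 2"
proof -
  have "fps_norm1 n step_inv_fps = 1 + (\<Sum>j<n. w * (1 - w) ^ j)"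
    unfolding fps_norm1_def using assms
    by (simp add: lessThan_Suc_atMost[symmetric] sum.lessThan_Suc_shift step_inv_fps_def abs_mult
        del: sum.lessThan_Suc)
  also have "(\<Sum>j<n. w * (1 - w) ^ j) = 1 - (1 - w) ^ n"
    by (induction n) (auto simp: algebra_simps)
  finally show ?thesis using assms by simp
qed

text \<open>Writing \<open>G = F (1 + E)\<close> with \<open>F = (1 - (1 - w) X) / (1 - X)\<close>, the logarithmic derivatives add
  up, \<open>F\<close> contributes exactly \<open>1 - (1 - w) ^ n\<close>, and \<open>E\<close> is small in the coefficientwise l1-norm.\<close>

lemma log_deriv_coeff_estimate:
  fixes G :: "real fps"
  assumes w: "0 \<le> w" "w \<le> 1" and G0: "G $ 0 = 1"
    and sum_le: "(\<Sum>g=1..n. \<bar>G $ g - w\<bar>) \<le> \<eta>" and \<eta>: "\<eta> \<le> 1 / 4"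
    and sup_le: "\<And>g. 1 \<le> g \<Longrightarrow> g \<le> n \<Longrightarrow> real g * \<bar>G $ g - w\<bar> \<le> \<delta>"
    and "0 \<le> \<delta>"
  shows "\<bar>1 - (fps_X * fps_deriv G * inverse G) $ n - (1 - w) ^ n\<bar> \<le> 2 * (\<delta> + real n * w * \<eta>)"
proof -
  define D where "D = G - step_fps"
  define E where "E = D * step_inv_fps"
  define V where "V = inverse (1 + E)"
  have Dn: "D $ g = G $ g - w" if "g > 0" for g
    using that by (simp add: D_def step_fps_def)
  have D0: "D $ 0 = 0"
    using G0 by (auto simp: D_def step_fps_def)
  have E0: "E $ 0 = 0" by (simp add: E_def D0)
  have normD: "fps_norm1 n D \<le> \<eta>"
  proof -
    have "fps_norm1 n D = (\<Sum>g=1..n. \<bar>D $ g\<bar>)"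
      unfolding fps_norm1_def by (rule sum.mono_neutral_right) (auto simp: D0 Suc_le_eq)
    also have "\<dots> = (\<Sum>g=1..n. \<bar>G $ g - w\<bar>)" by (rule sum.cong) (auto simp: Dn)
    finally show ?thesis using sum_le by simp
  qed
  have "fps_norm1 n E \<le> \<eta> * 2"
    unfolding E_def
    using fps_norm1_mult[of n D step_inv_fps] normD fps_norm1_step_inv_le[OF w, of n]
      mult_mono[OF normD fps_norm1_step_inv_le[OF w, of n]] fps_norm1_nonneg[of n D]
      fps_norm1_nonneg[of n step_inv_fps]
    by linarith
  then have normV: "fps_norm1 n V \<le> 2"
    unfolding V_def using \<eta> E0 by (intro fps_norm1_inverse_le) auto
  have EV: "(1 + E) * V = 1"
    unfolding V_def using E0 by (intro inverse_mult_eq_1') simp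
  have G_eq: "G = step_fps * (1 + E)"
  proof -
    have "step_fps * (1 + E) = step_fps + (step_fps * step_inv_fps) * D"
      by (simp add: E_def algebra_simps)
    then show ?thesis by (simp add: step_fps_mult_inv D_def)
  qed
  have "G * (step_inv_fps * V) = (step_fps * step_inv_fps) * ((1 + E) * V)"
    unfolding G_eq by (simp only: ac_simps)
  then have inv_G: "inverse G = step_inv_fps * V"
    unfolding step_fps_mult_inv EV by (intro fps_inverse_unique) simp
  have "fps_X * fps_deriv G * inverse G
      = (fps_X * fps_deriv step_fps * step_inv_fps) * ((1 + E) * V)
        + (step_fps * step_inv_fps) * (fps_X * fps_deriv E * V)"
    unfolding inv_G by (simp add: G_eq algebra_simps)
  also have "\<dots> = Abs_fps (\<lambda>n. 1 - (1 - w) ^ n) + fps_X * fps_deriv E * V"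
    by (simp add: step_fps_mult_inv EV step_fps_log_deriv)
  finally have eq: "1 - (fps_X * fps_deriv G * inverse G) $ n - (1 - w) ^ n
      = - (fps_X * fps_deriv E * V) $ n"
    by simp
  \<comment> \<open>The term \<open>j = i\<close> of the convolution is the deviation
    \<open>D $ i\<close> itself and is charged to \<delta>. All other terms carry a coefficient of
    \<open>1/F\<close> of modulus at most \<open>w\<close>, and together cost at most
    \<open>n w \<eta>\<close>.\<close>
  have coeff_E: "real i * \<bar>E $ i\<bar> \<le> \<delta> + real n * w * \<eta>" if "i \<le> n" for i
  proof (cases "i = 0")
    case True
    have "0 \<le> \<eta>" using normD fps_norm1_nonneg[of n D] by simp
    then show ?thesis using True \<open>0 \<le> \<delta>\<close> w by simp
  next
    case False
    have "E $ i = (\<Sum>j=0..i. D $ j * step_inv_fps $ (i - j))"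
      by (simp add: E_def fps_mult_nth)
    also have "\<dots> = (\<Sum>j<i. D $ j * step_inv_fps $ (i - j)) + D $ i"
      by (simp add: atLeast0AtMost lessThan_Suc_atMost[symmetric] step_inv_fps_def)
    finally have "\<bar>E $ i\<bar> \<le> (\<Sum>j<i. \<bar>D $ j * step_inv_fps $ (i - j)\<bar>) + \<bar>D $ i\<bar>"
      using sum_abs[of "\<lambda>j. D $ j * step_inv_fps $ (i - j)" "{..<i}"] by linarith
    also have "(\<Sum>j<i. \<bar>D $ j * step_inv_fps $ (i - j)\<bar>) \<le> (\<Sum>j<i. \<bar>D $ j\<bar> * w)"
    proof (rule sum_mono)
      fix j assume "j \<in> {..<i}"
      then have "\<bar>step_inv_fps $ (i - j)\<bar> = w * (1 - w) ^ (i - j - 1)"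
        using w by (auto simp: step_inv_fps_def abs_mult)
      also have "\<dots> \<le> w" using w by (intro mult_left_le power_le_one) auto
      finally show "\<bar>D $ j * step_inv_fps $ (i - j)\<bar> \<le> \<bar>D $ j\<bar> * w"
        by (simp add: abs_mult mult_left_mono)
    qed
    also have "(\<Sum>j<i. \<bar>D $ j\<bar> * w) \<le> \<eta> * w"
    proof -
      have "(\<Sum>j<i. \<bar>D $ j\<bar>) \<le> fps_norm1 n D"
        unfolding fps_norm1_def using that by (intro sum_mono2) auto
      then show ?thesis using normD w
        by (simp add: sum_distrib_right[symmetric] mult_right_mono)
    qed
    finally have "real i * \<bar>E $ i\<bar> \<le> real i * (\<eta> * w + \<bar>D $ i\<bar>)"
      by (intro mult_left_mono) auto
    also have "\<dots> \<le> real n * (\<eta> * w) + \<delta>"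
    proof -
      have "0 \<le> \<eta>" using normD fps_norm1_nonneg[of n D] by simp
      then have "real i * (\<eta> * w) \<le> real n * (\<eta> * w)"
        using that w by (intro mult_right_mono) auto
      then show ?thesis using sup_le[of i] False that by (simp add: Dn distrib_left)
    qed
    finally show ?thesis by (simp add: mult_ac)
  qed
  \<comment> \<open>The coefficients \<open>i E_i\<close> of \<open>X E'\<close> share one bound, so
    the convolution with \<open>V\<close> costs only the norm of \<open>V\<close>.\<close>
  have "\<bar>(fps_X * fps_deriv E * V) $ n\<bar> \<le> (\<Sum>i=0..n. \<bar>(fps_X * fps_deriv E) $ i * V $ (n - i)\<bar>)"
    unfolding fps_mult_nth[of "fps_X * fps_deriv E"] by (rule sum_abs)
  also have "\<dots> \<le> (\<Sum>i=0..n. (\<delta> + real n * w * \<eta>) * \<bar>V $ (n - i)\<bar>)"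
  proof (rule sum_mono)
    fix i assume "i \<in> {0..n}"
    moreover have "(fps_X * fps_deriv E) $ i = real i * E $ i" by (cases i) auto
    ultimately show "\<bar>(fps_X * fps_deriv E) $ i * V $ (n - i)\<bar> \<le> (\<delta> + real n * w * \<eta>) * \<bar>V $ (n - i)\<bar>"
      using coeff_E[of i] by (auto simp: abs_mult intro!: mult_right_mono)
  qed
  also have "\<dots> = (\<delta> + real n * w * \<eta>) * fps_norm1 n V"
  proof -
    have "(\<Sum>i=0..n. \<bar>V $ (n - i)\<bar>) = fps_norm1 n V"
      unfolding fps_norm1_def atLeast0AtMost by (rule sum.reindex_bij_witness[of _ "\<lambda>i. n - i" "\<lambda>i. n - i"]) auto
    then show ?thesis by (simp add: sum_distrib_left[symmetric])
  qed
  also have "\<dots> \<le> (\<delta> + real n * w * \<eta>) * 2"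
    using normV coeff_E[of 0] by (intro mult_left_mono) auto
  finally show ?thesis unfolding eq by simp
qed

end

section \<open>Cyclic gaps and inclusion-exclusion\<close>

definition hit_count :: "nat \<Rightarrow> nat set \<Rightarrow> nat \<Rightarrow> nat" where
  "hit_count n A r = card {u. u < n \<and> arc n u r \<inter> A \<noteq> {}}"

definition chain :: "nat \<Rightarrow> nat \<Rightarrow> nat set set" where
  "chain a b = {A. A \<subseteq> {a..b} \<and> a \<in> A \<and> b \<in> A}"

text \<open>The half-open range gives a gap from \<open>c\<close> to the next point \<open>d\<close>
  exactly the starts \<open>c + 1, ..., d\<close>, so gaps do not overlap. The
  \<open>n - (b - a)\<close> starts left out belong to the gap wrapping around 0.\<close>

definition lin_count :: "nat \<Rightarrow> nat \<Rightarrow> nat set \<Rightarrow> nat \<Rightarrow> nat" where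
  "lin_count a b A r = card {u. a < u \<and> u \<le> b \<and> (\<exists>v\<in>A. u \<le> v \<and> v < u + r)}"

lemma finite_chain [simp]: "finite (chain a b)"
  by (rule finite_subset[of _ "Pow {a..b}"]) (auto simp: chain_def)

lemma chain_same [simp]: "chain a a = {{a}}"
  by (auto simp: chain_def)

text \<open>The conditional difference is the cyclic distance from \<open>u\<close> to
  \<open>v\<close>. A radius may exceed \<open>n\<close>, so an offset \<open>i < r\<close>
  witnessing membership is first reduced mod \<open>n\<close>; the reduced offset
  \<open>j \<le> i\<close> is that distance.\<close>

lemma mem_arc_iff:
  assumes "u < n" "v < n"
  shows "v \<in> arc n u r \<longleftrightarrow> (if u \<le> v then v - u else n + v - u) < r" (is "_ \<longleftrightarrow> ?d < r")
proof
  have d: "?d < n" "(u + ?d) mod n = v"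
    using assms by auto
  show "v \<in> arc n u r" if "?d < r"
    unfolding arc_def mem_Collect_eq by (rule exI[of _ ?d], rule conjI[OF d(2)[symmetric] that])
  show "?d < r" if "v \<in> arc n u r"
  proof -
    from that obtain i where i: "i < r" "v = (u + i) mod n" by (auto simp: arc_def)
    obtain j where j: "j = i mod n" "j < n" using assms by simp
    have v: "v = (u + j) mod n" unfolding j(1) using i(2) by (simp add: mod_simps)
    have "?d = j"
    proof (cases "u + j < n")
      case False
      then have "v = u + j - n" using v j(2) assms by (simp add: le_mod_geq not_less)
      then show ?thesis using False j(2) assms by auto
    qed (use v in simp)
    also have "j \<le> i" by (simp add: j(1))
    finally show ?thesis using i(1) by linarith
  qed
qed

text \<open>An arc meets \<open>A\<close> iff it reaches the first point of \<open>A\<close> at or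
  cyclically after its start, so a gap of length \<open>g\<close> contributes \<open>min r g\<close>
  starts. Outside \<open>(a, b]\<close> that first point is always \<open>a\<close>; these starts
  form the wrapping gap.\<close>

lemma hit_count_chain:
  assumes A: "A \<in> chain a b" and "b < n"
  shows "hit_count n A r = lin_count a b A r + min r (n - (b - a))"
proof -
  have A': "A \<subseteq> {a..b}" "a \<in> A" "b \<in> A" and "a \<le> b"
    using A by (auto simp: chain_def)
  let ?H = "\<lambda>u. arc n u r \<inter> A \<noteq> {}"
  have H: "?H u \<longleftrightarrow> (\<exists>v\<in>A. (if u \<le> v then v - u else n + v - u) < r)" if "u < n" for u
  proof -
    have lt: "v < n" if "v \<in> A" for v using that A'(1) \<open>b < n\<close> by auto
    have "?H u \<longleftrightarrow> (\<exists>v\<in>A. v \<in> arc n u r)" by blast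
    also have "\<dots> \<longleftrightarrow> (\<exists>v\<in>A. (if u \<le> v then v - u else n + v - u) < r)"
      by (rule bex_cong[OF refl]) (rule mem_arc_iff[OF that lt])
    finally show ?thesis .
  qed
  have mid: "?H u \<longleftrightarrow> (\<exists>v\<in>A. u \<le> v \<and> v < u + r)" if "a < u" "u \<le> b" for u
  proof -
    have "u < n" using that \<open>b < n\<close> by simp
    show ?thesis unfolding H[OF \<open>u < n\<close>]
    proof
      assume "\<exists>v\<in>A. (if u \<le> v then v - u else n + v - u) < r"
      then obtain v where v: "v \<in> A" "(if u \<le> v then v - u else n + v - u) < r" by blast
      show "\<exists>v\<in>A. u \<le> v \<and> v < u + r"
      proof (cases "u \<le> v")
        \<comment> \<open>An arc reaching some \<open>v < u\<close> has wrapped past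
          \<open>n\<close>, hence already passed \<open>b\<close>.\<close>
        case False
        then have "b < u + r" using v that \<open>b < n\<close> by auto
        then show ?thesis using A'(3) that by blast
      qed (use v in auto)
    next
      assume "\<exists>v\<in>A. u \<le> v \<and> v < u + r"
      then obtain v where "v \<in> A" "u \<le> v" "v < u + r" by blast
      then show "\<exists>v\<in>A. (if u \<le> v then v - u else n + v - u) < r"
        by (intro bexI[of _ v]) auto
    qed
  qed
  have low: "?H u \<longleftrightarrow> a < u + r" if "u \<le> a" for u
  proof -
    have "u < n" using that \<open>b < n\<close> \<open>a \<le> b\<close> by simp
    show ?thesis unfolding H[OF \<open>u < n\<close>]
    proof
      assume "\<exists>v\<in>A. (if u \<le> v then v - u else n + v - u) < r"
      then obtain v where v: "v \<in> A" "(if u \<le> v then v - u else n + v - u) < r" by blast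
      then have "a \<le> v" using A'(1) by auto
      then show "a < u + r" using that v(2) by (auto split: if_splits)
    next
      assume "a < u + r"
      then show "\<exists>v\<in>A. (if u \<le> v then v - u else n + v - u) < r"
        using that A'(2) by (intro bexI[of _ a]) auto
    qed
  qed
  have high: "?H u \<longleftrightarrow> n + a < u + r" if "b < u" "u < n" for u
    unfolding H[OF that(2)]
  proof
    assume "\<exists>v\<in>A. (if u \<le> v then v - u else n + v - u) < r"
    then obtain v where v: "v \<in> A" "(if u \<le> v then v - u else n + v - u) < r" by blast
    then have "a \<le> v" "v \<le> b" using A'(1) by auto
    then show "n + a < u + r" using that v(2) \<open>b < n\<close> by auto
  next
    assume "n + a < u + r"
    then show "\<exists>v\<in>A. (if u \<le> v then v - u else n + v - u) < r"
      using that A'(2) \<open>a \<le> b\<close> by (intro bexI[of _ a]) auto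
  qed
  let ?M = "{u. a < u \<and> u \<le> b \<and> (\<exists>v\<in>A. u \<le> v \<and> v < u + r)}"
  \<comment> \<open>The successful starts of the wrapping gap on the two sides of 0: natural
    subtraction cuts \<open>?L\<close> off at 0, and \<open>max\<close> cuts \<open>?R\<close> off
    just after \<open>b\<close>.\<close>
  let ?L = "{Suc a - r..a}" and ?R = "{max (Suc b) (Suc (n + a) - r)..<n}"
  have "{u. u < n \<and> ?H u} = (?M \<union> ?L) \<union> ?R"
  proof (rule set_eqI)
    fix u
    consider "u \<le> a" | "a < u" "u \<le> b" | "b < u" "u < n" | "n \<le> u" by linarith
    then show "u \<in> {u. u < n \<and> ?H u} \<longleftrightarrow> u \<in> (?M \<union> ?L) \<union> ?R"
      using \<open>b < n\<close> \<open>a \<le> b\<close> low[of u] mid[of u] high[of u] by cases auto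
  qed
  moreover have "card ((?M \<union> ?L) \<union> ?R) = (card ?M + card ?L) + card ?R"
  proof -
    have "finite ?M" by (rule finite_subset[of _ "{..b}"]) auto
    then show ?thesis using \<open>a \<le> b\<close> by (subst card_Un_disjoint; (subst card_Un_disjoint)?) auto
  qed
  moreover have "card ?L + card ?R = min r (n - (b - a))"
    using \<open>a \<le> b\<close> \<open>b < n\<close> by auto
  ultimately show ?thesis unfolding hit_count_def lin_count_def by (simp only: add.assoc)
qed

text \<open>An arc that starts at or before \<open>c\<close> and reaches \<open>b\<close> also
  contains \<open>c\<close>, so the old count is unaffected; the starts \<open>c + 1, ..., b\<close>
  form one new gap.\<close>

lemma lin_count_insert:
  assumes A: "A \<in> chain a c" and "c < b"
  shows "lin_count a b (insert b A) r = lin_count a c A r + min r (b - c)"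
proof -
  have A': "A \<subseteq> {a..c}" "a \<in> A" "c \<in> A" and "a \<le> c"
    using A by (auto simp: chain_def)
  let ?M = "{u. a < u \<and> u \<le> c \<and> (\<exists>v\<in>A. u \<le> v \<and> v < u + r)}"
  let ?R = "{max (Suc c) (Suc b - r)..b}"
  have "{u. a < u \<and> u \<le> b \<and> (\<exists>v\<in>insert b A. u \<le> v \<and> v < u + r)} = ?M \<union> ?R"
  proof (rule set_eqI)
    fix u
    have 1: "(\<exists>v\<in>insert b A. u \<le> v \<and> v < u + r) \<longleftrightarrow> (\<exists>v\<in>A. u \<le> v \<and> v < u + r)" if "u \<le> c"
      using that A'(3) \<open>c < b\<close> by (metis insert_iff le_trans less_imp_le_nat less_le_trans not_less)
    have 2: "(\<exists>v\<in>insert b A. u \<le> v \<and> v < u + r) \<longleftrightarrow> b < u + r" if "c < u" "u \<le> b"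
      using that A'(1) by fastforce
    consider "u \<le> c" | "c < u" "u \<le> b" | "b < u" by linarith
    then show "u \<in> {u. a < u \<and> u \<le> b \<and> (\<exists>v\<in>insert b A. u \<le> v \<and> v < u + r)} \<longleftrightarrow> u \<in> ?M \<union> ?R"
      using 1 2 \<open>a \<le> c\<close> \<open>c < b\<close> by cases auto
  qed
  moreover have "card (?M \<union> ?R) = card ?M + card ?R"
  proof -
    have "finite ?M" by (rule finite_subset[of _ "{..c}"]) auto
    then show ?thesis by (subst card_Un_disjoint) auto
  qed
  moreover have "card ?R = min r (b - c)"
    using \<open>c < b\<close> by auto
  ultimately show ?thesis unfolding lin_count_def by (simp only: add.assoc)
qed

text \<open>Deleting \<open>b\<close> from \<open>A\<close> leaves a set with greatest point
  \<open>c\<close>, so the sum is sorted by the last gap \<open>b - c\<close>. This drives the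
  renewal recursion.\<close>

lemma sum_chain:
  assumes "a < b"
  shows "(\<Sum>A\<in>chain a b. f A) = (\<Sum>c=a..<b. \<Sum>A\<in>chain a c. f (insert b A))"
proof -
  have *: "chain a b = (\<Union>c\<in>{a..<b}. insert b ` chain a c)"
  proof (intro equalityI subsetI)
    fix A assume A: "A \<in> chain a b"
    let ?c = "Max (A - {b})"
    have fin: "finite A" using A by (auto simp: chain_def intro: finite_subset)
    have ne: "a \<in> A - {b}" using A assms by (auto simp: chain_def)
    have c: "?c \<in> A - {b}" using fin ne by (intro Max_in) auto
    have "A - {b} \<subseteq> {a..?c}"
    proof
      fix x assume "x \<in> A - {b}"
      then show "x \<in> {a..?c}"
        using fin A by (auto simp: chain_def intro!: Max_ge)
    qed
    then have "A - {b} \<in> chain a ?c"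
      using ne c by (auto simp: chain_def)
    moreover have "A = insert b (A - {b})" using A by (auto simp: chain_def)
    moreover have "?c \<in> {a..<b}" using c A by (auto simp: chain_def)
    ultimately show "A \<in> (\<Union>c\<in>{a..<b}. insert b ` chain a c)" by blast
  next
    fix B assume "B \<in> (\<Union>c\<in>{a..<b}. insert b ` chain a c)"
    then obtain c A where c: "a \<le> c" "c < b" "A \<subseteq> {a..c}" "a \<in> A" and B: "B = insert b A"
      by (auto simp: chain_def)
    from c have "A \<subseteq> {a..b}" by force
    then show "B \<in> chain a b" using c by (simp add: B chain_def)
  qed
  have inj: "inj_on (insert b) (chain a c)" if "c < b" for c
  proof (rule inj_onI)
    fix A B assume "A \<in> chain a c" "B \<in> chain a c" "insert b A = insert b B"
    moreover from this that have "b \<notin> A" "b \<notin> B" by (auto simp: chain_def)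
    ultimately show "A = B" by (metis insert_ident)
  qed
  have disj: "insert b ` chain a c \<inter> insert b ` chain a d = {}" if "c < b" "d < b" "c \<noteq> d" for c d
  proof -
    have "False" if "A \<in> chain a c" "B \<in> chain a d" "insert b A = insert b B" for A B
    proof -
      have "b \<notin> A" "b \<notin> B" using that \<open>c < b\<close> \<open>d < b\<close> by (auto simp: chain_def)
      then have "A = B" using that(3) by (metis insert_ident)
      with that(1,2) have "c \<le> d" "d \<le> c" by (auto simp: chain_def)
      with \<open>c \<noteq> d\<close> show False by simp
    qed
    then show ?thesis by blast
  qed
  show ?thesis
    unfolding *
    by (subst sum.UNION_disjoint) (auto simp: disj sum.reindex[OF inj] intro!: sum.cong)
qed

text \<open>A non-empty set lies in exactly one \<open>chain\<close>, given by its minimum and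
  maximum; this choice also fixes its wrapping gap.\<close>

lemma sum_Pow_chain:
  fixes f :: "nat set \<Rightarrow> 'a :: ab_group_add"
  shows "(\<Sum>A\<in>Pow {..<n}. f A) = f {} + (\<Sum>a<n. \<Sum>b=a..<n. \<Sum>A\<in>chain a b. f A)"
proof -
  let ?I = "SIGMA a:{..<n}. {a..<n}"
  have *: "Pow {..<n} - {{}} = (\<Union>p\<in>?I. chain (fst p) (snd p))"
  proof (intro equalityI subsetI)
    fix A assume A: "A \<in> Pow {..<n} - {{}}"
    then have fin: "finite A" "A \<noteq> {}" by (auto intro: finite_subset)
    have "A \<in> chain (Min A) (Max A)" using fin by (auto simp: chain_def)
    moreover have "(Min A, Max A) \<in> ?I"
      using fin A Min_in[OF fin] Max_in[OF fin] by (auto simp del: Min_in Max_in)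
    ultimately show "A \<in> (\<Union>p\<in>?I. chain (fst p) (snd p))" by force
  next
    fix A assume "A \<in> (\<Union>p\<in>?I. chain (fst p) (snd p))"
    then obtain a b where "a \<le> b" "b < n" "A \<subseteq> {a..b}" "a \<in> A"
      by (auto simp: chain_def)
    then show "A \<in> Pow {..<n} - {{}}" by force
  qed
  have disj: "chain a b \<inter> chain c d = {}" if "(a, b) \<noteq> (c, d)" for a b c d
  proof -
    have "(a, b) = (c, d)" if "A \<in> chain a b" "A \<in> chain c d" for A
    proof -
      from that have "a \<in> {c..d}" "c \<in> {a..b}" "b \<in> {c..d}" "d \<in> {a..b}"
        unfolding chain_def by blast+
      then show ?thesis by simp
    qed
    with that show ?thesis by blast
  qed
  have "(\<Sum>A\<in>Pow {..<n}. f A) = f {} + (\<Sum>A\<in>Pow {..<n} - {{}}. f A)"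
    by (subst sum.remove[of _ "{}"]) auto
  also have "(\<Sum>A\<in>Pow {..<n} - {{}}. f A) = (\<Sum>p\<in>?I. \<Sum>A\<in>chain (fst p) (snd p). f A)"
    unfolding * by (rule sum.UNION_disjoint) (auto simp: disj)
  also have "\<dots> = (\<Sum>a<n. \<Sum>b=a..<n. \<Sum>A\<in>chain a b. f A)"
    by (subst sum.Sigma) (auto simp: case_prod_beta)
  finally show ?thesis .
qed

lemma sum_pairs_by_difference:
  fixes h :: "nat \<Rightarrow> real"
  shows "(\<Sum>a<n. \<Sum>b=a..<n. h (b - a)) = (\<Sum>m<n. real (n - m) * h m)"
proof -
  have "(\<Sum>a<n. \<Sum>b=a..<n. h (b - a)) = (\<Sum>a<n. \<Sum>m<n - a. h m)"
    by (intro sum.cong refl sum.reindex_bij_witness[of _ "\<lambda>m. m + a" "\<lambda>b. b - a" for a]) auto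
  also have "\<dots> = (\<Sum>p\<in>(SIGMA a:{..<n}. {..<n - a}). h (snd p))"
    by (subst sum.Sigma) (auto simp: case_prod_beta)
  also have "\<dots> = (\<Sum>p\<in>(SIGMA m:{..<n}. {..<n - m}). h (fst p))"
    by (rule sum.reindex_bij_witness[of _ prod.swap prod.swap]) auto
  also have "\<dots> = (\<Sum>m<n. \<Sum>a<n - m. h m)"
    by (subst sum.Sigma) (auto simp: case_prod_beta)
  finally show ?thesis by simp
qed

section \<open>Renewal equation for the signed gap weights\<close>

context
  fixes p :: "nat pmf" and l :: real
begin

definition gap_mean :: "nat \<Rightarrow> real" where
  "gap_mean g = measure_pmf.expectation p (\<lambda>r. real (min r g))"

text \<open>\<open>l\<close> stands for the time per site \<open>t / n\<close>; the coefficient at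
  \<open>g\<close> is the factor of a gap of length \<open>g\<close> in the probability that a set
  is missed up to time \<open>t\<close>.\<close>

definition gap_fps :: "real fps" where
  "gap_fps = Abs_fps (\<lambda>g. if g = 0 then 1 else exp (- l * gap_mean g))"

text \<open>The exponent \<open>card A + 1\<close> gives a single point weight 1, and each further
  point multiplies the weight by minus the coefficient \<open>G_g\<close> of its gap. Sorting by the
  last gap, the sums satisfy \<open>u_0 = 1\<close> and
  \<open>u_m = - (G_1 u_(m-1) + ... + G_m u_0)\<close>, the recursion of \<open>1/G\<close>.\<close>

lemma sum_chain_weight:
  assumes "a \<le> b"
  shows "(\<Sum>A\<in>chain a b. (-1) ^ (card A + 1) *
      exp (- l * measure_pmf.expectation p (\<lambda>r. real (lin_count a b A r)))) = inverse gap_fps $ (b - a)"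
  using assms
proof (induction b rule: less_induct)
  case (less b)
  let ?L = "\<lambda>b A. measure_pmf.expectation p (\<lambda>r. real (lin_count a b A r))"
  have u0: "inverse gap_fps $ 0 = 1" by (simp add: gap_fps_def)
  show ?case
  proof (cases "a = b")
    case True
    have "lin_count b b {b} r = 0" for r by (auto simp: lin_count_def)
    then show ?thesis using True u0 by simp
  next
    case False
    then have "a < b" using less.prems by simp
    have ins: "(-1) ^ (card (insert b A) + 1) * exp (- l * ?L b (insert b A))
        = - exp (- l * gap_mean (b - c)) * ((-1) ^ (card A + 1) * exp (- l * ?L c A))"
      if A: "A \<in> chain a c" and c: "c < b" for A c
    proof -
      have "b \<notin> A" "finite A" using A c by (auto simp: chain_def intro: finite_subset)
      then have card: "card (insert b A) = card A + 1" by simp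
      have int1: "integrable p (\<lambda>r. real (lin_count a c A r))"
      proof (rule measure_pmf.integrable_const_bound[where B = "real c"])
        have "card {u. a < u \<and> u \<le> c \<and> (\<exists>v\<in>A. u \<le> v \<and> v < u + r)} \<le> card {1..c}" for r
          by (rule card_mono) auto
        then show "AE r in p. norm (real (lin_count a c A r)) \<le> real c"
          by (simp add: lin_count_def)
      qed simp
      have int2: "integrable p (\<lambda>r. real (min r (b - c)))"
        by (rule measure_pmf.integrable_const_bound[where B = "real (b - c)"]) auto
      have "?L b (insert b A) = ?L c A + gap_mean (b - c)"
        unfolding lin_count_insert[OF A c] gap_mean_def of_nat_add
        by (rule Bochner_Integration.integral_add[OF int1 int2])
      then show ?thesis unfolding card
        by (simp add: algebra_simps exp_add[symmetric])
    qed
    have "(\<Sum>A\<in>chain a b. (-1) ^ (card A + 1) * exp (- l * ?L b A))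
        = (\<Sum>c=a..<b. \<Sum>A\<in>chain a c. - exp (- l * gap_mean (b - c)) * ((-1) ^ (card A + 1) * exp (- l * ?L c A)))"
      unfolding sum_chain[OF \<open>a < b\<close>] by (intro sum.cong refl ins) auto
    also have "\<dots> = (\<Sum>c=a..<b. - exp (- l * gap_mean (b - c)) * inverse gap_fps $ (c - a))"
      unfolding sum_distrib_left[symmetric]
      by (intro sum.cong refl arg_cong2[where f = "(*)"] less.IH) auto
    also have "\<dots> = (\<Sum>g=1..b - a. - (gap_fps $ g) * inverse gap_fps $ (b - a - g))"
      by (rule sum.reindex_bij_witness[of _ "\<lambda>g. b - g" "\<lambda>c. b - c"]) (auto simp: gap_fps_def)
    also have "\<dots> = inverse gap_fps $ (b - a)"
    proof -
      have "gap_fps * inverse gap_fps = 1"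
        by (rule inverse_mult_eq_1') (simp add: gap_fps_def)
      then have "(gap_fps * inverse gap_fps) $ (b - a) = 0" using \<open>a < b\<close> by simp
      then have "gap_fps $ 0 * inverse gap_fps $ (b - a)
          + (\<Sum>g=1..b - a. gap_fps $ g * inverse gap_fps $ (b - a - g)) = 0"
        by (simp add: fps_mult_nth sum.atLeast_Suc_atMost)
      then show ?thesis by (simp add: gap_fps_def sum_negf)
    qed
    finally show ?thesis .
  qed
qed

text \<open>Closing a chain of span \<open>m = b - a\<close> on the circle adds the gap
  \<open>n - m\<close>, and \<open>a\<close> has \<open>n - m\<close> possible positions. Hence
  \<open>(n - m) G_(n-m) u_m\<close> summed over \<open>m\<close> is the coefficient of
  \<open>X G'\<close> times \<open>1/G\<close>. The minus sign is the parity shift against the chain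
  weights; the empty set contributes the 1.\<close>

lemma inclusion_exclusion_hit_count:
  "(\<Sum>A\<in>Pow {..<n}. (-1) ^ card A * exp (- l * measure_pmf.expectation p (\<lambda>r. real (hit_count n A r))))
    = 1 - (fps_X * fps_deriv gap_fps * inverse gap_fps) $ n"
proof -
  let ?u = "\<lambda>m. inverse gap_fps $ m"
  let ?h = "\<lambda>A. measure_pmf.expectation p (\<lambda>r. real (hit_count n A r))"
  have chain: "(\<Sum>A\<in>chain a b. (-1) ^ card A * exp (- l * ?h A)) = - (gap_fps $ (n - (b - a)) * ?u (b - a))"
    if "a \<le> b" "b < n" for a b
  proof -
    have ins: "(-1) ^ card A * exp (- l * ?h A) = - gap_fps $ (n - (b - a)) *
      ((-1) ^ (card A + 1) * exp (- l * measure_pmf.expectation p (\<lambda>r. real (lin_count a b A r))))"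
      if A: "A \<in> chain a b" for A
    proof -
      have int1: "integrable p (\<lambda>r. real (lin_count a b A r))"
      proof (rule measure_pmf.integrable_const_bound[where B = "real b"])
        have "card {u. a < u \<and> u \<le> b \<and> (\<exists>v\<in>A. u \<le> v \<and> v < u + r)} \<le> card {1..b}" for r
          by (rule card_mono) auto
        then show "AE r in p. norm (real (lin_count a b A r)) \<le> real b"
          by (simp add: lin_count_def)
      qed simp
      have int2: "integrable p (\<lambda>r. real (min r (n - (b - a))))"
        by (rule measure_pmf.integrable_const_bound[where B = "real (n - (b - a))"]) auto
      have "?h A = measure_pmf.expectation p (\<lambda>r. real (lin_count a b A r)) + gap_mean (n - (b - a))"
        unfolding hit_count_chain[OF A \<open>b < n\<close>] gap_mean_def of_nat_add
        by (rule Bochner_Integration.integral_add[OF int1 int2])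
      moreover have "n - (b - a) \<noteq> 0" using \<open>b < n\<close> by simp
      ultimately show ?thesis by (simp add: algebra_simps exp_add[symmetric] gap_fps_def)
    qed
    have "(\<Sum>A\<in>chain a b. (-1) ^ card A * exp (- l * ?h A)) = - gap_fps $ (n - (b - a)) * ?u (b - a)"
      unfolding sum_chain_weight[OF \<open>a \<le> b\<close>, symmetric] sum_distrib_left
      by (intro sum.cong refl ins)
    then show ?thesis by simp
  qed
  have "(\<Sum>A\<in>Pow {..<n}. (-1) ^ card A * exp (- l * ?h A))
      = 1 + (\<Sum>a<n. \<Sum>b=a..<n. - (gap_fps $ (n - (b - a)) * ?u (b - a)))"
    unfolding sum_Pow_chain
  proof (rule arg_cong2[where f = "(+)"])
    show "(\<Sum>a<n. \<Sum>b=a..<n. \<Sum>A\<in>chain a b. (-1) ^ card A * exp (- l * ?h A))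
      = (\<Sum>a<n. \<Sum>b=a..<n. - (gap_fps $ (n - (b - a)) * ?u (b - a)))"
      by (rule sum.cong[OF refl], rule sum.cong[OF refl], rule chain) auto
  qed (simp add: hit_count_def)
  also have "\<dots> = 1 - (\<Sum>m<n. real (n - m) * (gap_fps $ (n - m) * ?u m))"
    by (simp only: sum_negf sum_pairs_by_difference[of "\<lambda>m. gap_fps $ (n - m) * ?u m"])
  also have "(\<Sum>m<n. real (n - m) * (gap_fps $ (n - m) * ?u m)) = (\<Sum>i=0..n. (fps_X * fps_deriv gap_fps) $ i * ?u (n - i))"
  proof -
    have nth: "(fps_X * fps_deriv gap_fps) $ i = real i * gap_fps $ i" for i by (cases i) auto
    have "(\<Sum>i=0..n. (fps_X * fps_deriv gap_fps) $ i * ?u (n - i)) = (\<Sum>i=1..n. real i * (gap_fps $ i * ?u (n - i)))"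
      unfolding nth by (rule sum.mono_neutral_cong_right) (auto simp: Suc_le_eq)
    also have "\<dots> = (\<Sum>m<n. real (n - m) * (gap_fps $ (n - m) * ?u m))"
      by (rule sum.reindex_bij_witness[of _ "\<lambda>m. n - m" "\<lambda>m. n - m"]) auto
    finally show ?thesis by simp
  qed
  finally show ?thesis by (simp add: fps_mult_nth)
qed

end

section \<open>Asymptotics of the gap weights\<close>

text \<open>For the deficit: where \<open>R > g\<close>, the factor \<open>(R/g)^\<epsilon>\<close>
  is at least 1, so \<open>R - min(R, g)\<close> is at most
  \<open>R^(1+\<epsilon>) g^(-\<epsilon>)\<close>; elsewhere it vanishes.\<close>

lemma min_expectation_bounds:
  fixes p :: "nat pmf"
  assumes p: "set_pmf p \<subseteq> {1..}" and \<epsilon>: "\<epsilon> > 0"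
    and int: "integrable (measure_pmf p) (\<lambda>r. real r powr (1 + \<epsilon>))"
  shows integrable_real: "integrable (measure_pmf p) real"
    and expectation_ge_1: "measure_pmf.expectation p real \<ge> 1"
    and gap_mean_ge_1: "g \<ge> 1 \<Longrightarrow> gap_mean p g \<ge> 1"
    and gap_mean_le: "gap_mean p g \<le> measure_pmf.expectation p real"
    and gap_mean_deficit: "g \<ge> 1 \<Longrightarrow> measure_pmf.expectation p real - gap_mean p g
      \<le> measure_pmf.expectation p (\<lambda>r. real r powr (1 + \<epsilon>)) * real g powr (- \<epsilon>)"
proof -
  have ge1: "AE r in measure_pmf p. 1 \<le> r"
    using p by (auto simp: AE_measure_pmf_iff)
  show int_real: "integrable (measure_pmf p) real"
  proof (rule Bochner_Integration.integrable_bound[OF int])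
    show "AE r in measure_pmf p. norm (real r) \<le> norm (real r powr (1 + \<epsilon>))"
      using ge1
    proof eventually_elim
      case (elim r)
      then have "real r powr 1 \<le> real r powr (1 + \<epsilon>)" using \<epsilon> by (intro powr_mono) auto
      then show ?case using elim by simp
    qed
  qed simp
  have int_min: "integrable (measure_pmf p) (\<lambda>r. real (min r g))" for g
    by (rule measure_pmf.integrable_const_bound[where B = "real g"]) auto
  have "measure_pmf.expectation p (\<lambda>_. 1 :: real) \<le> measure_pmf.expectation p real"
    using ge1 by (intro integral_mono_AE int_real) auto
  then show "measure_pmf.expectation p real \<ge> 1" by simp
  show "gap_mean p g \<ge> 1" if "g \<ge> 1"
  proof -
    have "AE r in measure_pmf p. 1 \<le> real (min r g)"
      using ge1 by eventually_elim (use that in auto)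
    then have "measure_pmf.expectation p (\<lambda>_. 1 :: real) \<le> gap_mean p g"
      unfolding gap_mean_def by (intro integral_mono_AE int_min) auto
    then show ?thesis by simp
  qed
  show "gap_mean p g \<le> measure_pmf.expectation p real"
    unfolding gap_mean_def by (intro integral_mono int_min int_real) auto
  show "measure_pmf.expectation p real - gap_mean p g
      \<le> measure_pmf.expectation p (\<lambda>r. real r powr (1 + \<epsilon>)) * real g powr (- \<epsilon>)" if "g \<ge> 1"
  proof -
    have le: "real r - real (min r g) \<le> real r powr (1 + \<epsilon>) * real g powr (- \<epsilon>)" for r
    proof (cases "r \<le> g")
      case False
      then have "real r * 1 \<le> real r * ((real r / real g) powr \<epsilon>)"
        using that \<epsilon> by (intro mult_left_mono ge_one_powr_ge_zero) (auto simp: field_simps)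
      also have "\<dots> = real r powr (1 + \<epsilon>) * real g powr (- \<epsilon>)"
        using False by (simp add: powr_divide powr_add powr_minus field_simps)
      finally show ?thesis by simp
    qed simp
    have "measure_pmf.expectation p real - gap_mean p g = measure_pmf.expectation p (\<lambda>r. real r - real (min r g))"
      unfolding gap_mean_def by (rule Bochner_Integration.integral_diff[symmetric, OF int_real int_min])
    also have "\<dots> \<le> measure_pmf.expectation p (\<lambda>r. real r powr (1 + \<epsilon>) * real g powr (- \<epsilon>))"
      using le by (intro integral_mono Bochner_Integration.integrable_diff int_real int_min integrable_mult_left int) auto
    finally show ?thesis by simp
  qed
qed

lemma log_deriv_tendsto:
  fixes p :: "nat pmf" and x :: real
  assumes p: "set_pmf p \<subseteq> {1..}" and \<epsilon>: "\<epsilon> > 0"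
    and int: "integrable (measure_pmf p) (\<lambda>r. real r powr (1 + \<epsilon>))"
  defines "\<mu> \<equiv> measure_pmf.expectation p real"
  defines "G \<equiv> \<lambda>n::nat. gap_fps p ((ln (real n) + x) / \<mu>)"
  shows "(\<lambda>n. 1 - fps_nth (fps_X * fps_deriv (G n) * inverse (G n)) n) \<longlonglongrightarrow> exp (- exp (- x))"
proof -
  define C where "C = measure_pmf.expectation p (\<lambda>r. real r powr (1 + \<epsilon>))"
  \<comment> \<open>Half of the exponent in \<open>exp (- l n) ~ n^(-1/\<mu>) = n^(-2a)\<close>, up
    to a constant factor. The threshold \<open>L n = n^a\<close> still tends to infinity as a power,
    while \<open>L n * exp (- l n)\<close> decays like \<open>n^(-a)\<close>.\<close>
  define a where "a = 1 / (2 * \<mu>)"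
  define l where "l = (\<lambda>n::nat. (ln (real n) + x) / \<mu>)"
  define w where "w = (\<lambda>n::nat. exp (- x) / real n)"
  define L where "L = (\<lambda>n::nat. real n powr a)"
  \<comment> \<open>\<open>B1\<close> handles the gaps up to \<open>L n\<close>. \<open>B2\<close>
    bounds the relative excess over \<open>w\<close> beyond it, and \<open>exp (- x) * B2\<close> is
    this excess accumulated over \<open>n\<close> gaps of weight \<open>w\<close>.\<close>
  define B1 where "B1 = (\<lambda>n. L n * exp (- l n))"
  define B2 where "B2 = (\<lambda>n. exp (l n * (C * L n powr (- \<epsilon>))) - 1)"
  define B where "B = (\<lambda>n. B1 n + exp (- x) * B2 n)"
  note bounds = min_expectation_bounds[OF p \<epsilon> int, folded \<mu>_def C_def]
  have "\<mu> \<ge> 1" by (rule bounds(2))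
  then have "a > 0" by (simp add: a_def)
  have "C \<ge> 0" unfolding C_def by simp
  have l_a: "l n = 2 * a * (ln (real n) + x)" for n by (simp add: l_def a_def)
  have B1_lim: "B1 \<longlonglongrightarrow> 0"
  proof -
    have "(\<lambda>n::nat. exp (- (2 * a * x)) * real n powr (- a)) \<longlonglongrightarrow> 0"
      using \<open>a > 0\<close> by real_asymp
    moreover have "\<forall>\<^sub>F n in sequentially. exp (- (2 * a * x)) * real n powr (- a) = B1 n"
      using eventually_gt_at_top[of 0]
      by eventually_elim
        (simp add: B1_def L_def l_a powr_def exp_add[symmetric] exp_minus[symmetric] algebra_simps)
    ultimately show ?thesis by (rule Lim_transform_eventually)
  qed
  have B2_lim: "B2 \<longlonglongrightarrow> 0"
  proof -
    define b where "b = a * \<epsilon>"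
    have "b > 0" using \<open>a > 0\<close> \<epsilon> by (simp add: b_def)
    then have "(\<lambda>n::nat. (ln (real n) + x) * real n powr (- b)) \<longlonglongrightarrow> 0"
      by real_asymp
    from tendsto_mult_left[OF this, of "2 * a * C"]
    have "(\<lambda>n. l n * (C * L n powr (- \<epsilon>))) \<longlonglongrightarrow> 0"
      by (simp add: l_a L_def powr_powr b_def algebra_simps)
    then have "B2 \<longlonglongrightarrow> exp 0 - 1"
      unfolding B2_def by (intro tendsto_intros)
    then show ?thesis by simp
  qed
  have B_lim: "B \<longlonglongrightarrow> 0"
    unfolding B_def using tendsto_add[OF B1_lim tendsto_mult_left[OF B2_lim, of "exp (- x)"]] by simp
  have ev: "\<forall>\<^sub>F n in sequentially. norm (1 - fps_nth (fps_X * fps_deriv (G n) * inverse (G n)) n - (1 - w n) ^ n)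
      \<le> 2 * (B n + exp (- x) * B n)"
  proof -
    have "\<forall>\<^sub>F n in sequentially. B n < 1 / 4"
      using B_lim by (rule order_tendstoD) simp
    moreover have "\<forall>\<^sub>F n::nat in sequentially. exp (- x) / real n \<le> 1"
      by real_asymp
    moreover have "\<forall>\<^sub>F n::nat in sequentially. ln (real n) + x \<ge> 0"
      by real_asymp
    ultimately show ?thesis
      using eventually_gt_at_top[of 0]
    proof eventually_elim
      case (elim n)
      have "l n \<ge> 0" using elim \<open>\<mu> \<ge> 1\<close> by (simp add: l_def)
      have w_eq: "w n = exp (- l n * \<mu>)"
      proof -
        have "l n * \<mu> = ln (real n) + x" using \<open>\<mu> \<ge> 1\<close> by (simp add: l_def)
        then show ?thesis using elim by (simp add: w_def exp_diff exp_minus exp_add field_simps)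
      qed
      have "B2 n \<ge> 0"
        using \<open>l n \<ge> 0\<close> \<open>C \<ge> 0\<close> by (simp add: B2_def)
      have "w n \<ge> 0" by (simp add: w_def)
      have nw: "real n * w n = exp (- x)" using elim by (simp add: w_def)
      have G_nth: "fps_nth (G n) g = exp (- l n * gap_mean p g)" if "g \<ge> 1" for g
        using that by (simp add: G_def gap_fps_def l_def)
      have diff_nonneg: "0 \<le> fps_nth (G n) g - w n" if "g \<ge> 1" for g
        using bounds(4)[of g] \<open>l n \<ge> 0\<close> by (simp add: G_nth[OF that] w_eq mult_left_mono)
      have small: "\<bar>fps_nth (G n) g - w n\<bar> \<le> exp (- l n)" if "g \<ge> 1" for g
      proof -
        have "fps_nth (G n) g \<le> exp (- l n)"
          using bounds(3)[OF that] \<open>l n \<ge> 0\<close> mult_left_mono[of 1 "gap_mean p g" "l n"]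
          by (simp add: G_nth[OF that])
        then show ?thesis using diff_nonneg[OF that] \<open>w n \<ge> 0\<close> by simp
      qed
      \<comment> \<open>The ratio of a coefficient to \<open>w\<close> is
        \<open>exp (l (\<mu> - gap_mean g))\<close>, and the power
        \<open>L n powr (- \<epsilon>)\<close> bounding the deficit outweighs the logarithm in
        \<open>l\<close>.\<close>
      have large: "\<bar>fps_nth (G n) g - w n\<bar> \<le> w n * B2 n" if "g \<ge> 1" "L n \<le> real g" for g
      proof -
        have "L n > 0" using elim by (simp add: L_def)
        have "\<mu> - gap_mean p g \<le> C * real g powr (- \<epsilon>)" by (rule bounds(5)[OF that(1)])
        also have "\<dots> \<le> C * L n powr (- \<epsilon>)"
          using that \<open>L n > 0\<close> \<open>C \<ge> 0\<close> \<epsilon> by (intro mult_left_mono powr_mono2') auto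
        finally have "l n * (\<mu> - gap_mean p g) \<le> l n * (C * L n powr (- \<epsilon>))"
          using \<open>l n \<ge> 0\<close> by (rule mult_left_mono)
        then have "exp (- l n * \<mu>) * exp (l n * (\<mu> - gap_mean p g)) \<le> w n * (B2 n + 1)"
          unfolding w_eq B2_def by (intro mult_left_mono) auto
        moreover have "exp (- l n * \<mu>) * exp (l n * (\<mu> - gap_mean p g)) = fps_nth (G n) g"
          by (simp add: G_nth[OF that(1)] exp_add[symmetric] algebra_simps)
        ultimately show ?thesis using diff_nonneg[OF that(1)] by (simp add: algebra_simps)
      qed
      have "real g * \<bar>fps_nth (G n) g - w n\<bar> \<le> B n" if "1 \<le> g" "g \<le> n" for g
      proof (cases "real g \<le> L n")
        case True
        then have "real g * \<bar>fps_nth (G n) g - w n\<bar> \<le> L n * exp (- l n)"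
          using small[OF that(1)] by (intro mult_mono) auto
        then show ?thesis using \<open>B2 n \<ge> 0\<close> by (simp add: B_def B1_def add_increasing2)
      next
        case False
        then have "real g * \<bar>fps_nth (G n) g - w n\<bar> \<le> real n * (w n * B2 n)"
          using large[OF that(1)] that by (intro mult_mono) auto
        also have "\<dots> = exp (- x) * B2 n" using nw by (simp add: mult.assoc[symmetric])
        finally show ?thesis by (simp add: B_def B1_def L_def add_increasing)
      qed
      moreover have "(\<Sum>g=1..n. \<bar>fps_nth (G n) g - w n\<bar>) \<le> B n"
      proof -
        have "(\<Sum>g=1..n. \<bar>fps_nth (G n) g - w n\<bar>) \<le> (\<Sum>g=1..n. (if real g \<le> L n then exp (- l n) else 0) + w n * B2 n)"
        proof (rule sum_mono)
          fix g assume "g \<in> {1..n}"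
          then show "\<bar>fps_nth (G n) g - w n\<bar> \<le> (if real g \<le> L n then exp (- l n) else 0) + w n * B2 n"
            using small[of g] large[of g] mult_nonneg_nonneg[OF \<open>w n \<ge> 0\<close> \<open>B2 n \<ge> 0\<close>] by auto
        qed
        also have "\<dots> = real (card {g\<in>{1..n}. real g \<le> L n}) * exp (- l n) + real n * w n * B2 n"
          by (simp add: sum.distrib sum.If_cases Int_def)
        also have "real (card {g\<in>{1..n}. real g \<le> L n}) \<le> L n"
        proof -
          have "card {g\<in>{1..n}. real g \<le> L n} \<le> card {1..nat \<lfloor>L n\<rfloor>}"
            by (intro card_mono) (auto simp: le_nat_floor)
          then have "real (card {g\<in>{1..n}. real g \<le> L n}) \<le> real (nat \<lfloor>L n\<rfloor>)" by simp
          also have "\<dots> \<le> L n" by (simp add: L_def of_nat_floor)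
          finally show ?thesis .
        qed
        finally show ?thesis by (simp add: B_def B1_def nw mult_right_mono)
      qed
      moreover have "B n \<ge> 0"
        using \<open>B2 n \<ge> 0\<close> by (simp add: B_def B1_def L_def)
      \<comment> \<open>The single quantity \<open>B n\<close> serves as both \<eta> and \<delta> of
        the coefficient estimate.\<close>
      ultimately have "\<bar>1 - fps_nth (fps_X * fps_deriv (G n) * inverse (G n)) n - (1 - w n) ^ n\<bar>
          \<le> 2 * (B n + real n * w n * B n)"
        using elim \<open>w n \<ge> 0\<close>
        by (intro log_deriv_coeff_estimate) (auto simp: w_def G_def gap_fps_def)
      then show ?case by (simp add: nw)
    qed
  qed
  have "(\<lambda>n. 2 * (B n + exp (- x) * B n)) \<longlonglongrightarrow> 2 * (0 + exp (- x) * 0)"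
    by (intro tendsto_intros B_lim)
  then have "(\<lambda>n. 1 - fps_nth (fps_X * fps_deriv (G n) * inverse (G n)) n - (1 - w n) ^ n) \<longlonglongrightarrow> 0"
    using Lim_null_comparison[OF ev] by simp
  moreover have "(\<lambda>n. (1 - w n) ^ n) \<longlonglongrightarrow> exp (- exp (- x))"
    using tendsto_exp_limit_sequentially[of "- exp (- x)"] by (simp add: w_def)
  ultimately show ?thesis
    using Lim_transform by fastforce
qed

section \<open>Independence of the components of a sequence of pairs\<close>

lemma emeasure_pair_sequence_cylinder:
  assumes M1: "prob_space M1" and M2: "prob_space M2"
    and A: "\<And>k. A k \<in> sets M1" and B: "\<And>k. B k \<in> sets M2"
  defines "P \<equiv> \<Pi>\<^sub>M k\<in>(UNIV :: nat set). M1 \<Otimes>\<^sub>M M2"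
  shows "emeasure P {\<omega> \<in> space P. \<forall>k<m. fst (\<omega> k) \<in> A k \<and> snd (\<omega> k) \<in> B k}
    = (\<Prod>k<m. emeasure M1 (A k)) * (\<Prod>k<m. emeasure M2 (B k))"
proof -
  interpret M1: prob_space M1 by fact
  interpret M2: prob_space M2 by fact
  interpret pair: pair_prob_space M1 M2 ..
  interpret seq: product_prob_space "\<lambda>_ :: nat. M1 \<Otimes>\<^sub>M M2" UNIV ..
  have "{\<omega> \<in> space P. \<forall>k<m. fst (\<omega> k) \<in> A k \<and> snd (\<omega> k) \<in> B k}
      = {\<omega> \<in> space P. \<forall>k\<in>{..<m}. \<omega> k \<in> A k \<times> B k}"
    by (auto simp: mem_Times_iff)
  also have "emeasure P \<dots> = (\<Prod>k\<in>{..<m}. emeasure (M1 \<Otimes>\<^sub>M M2) (A k \<times> B k))"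
    unfolding P_def using A B by (intro seq.emeasure_PiM_Collect) auto
  also have "\<dots> = (\<Prod>k<m. emeasure M1 (A k) * emeasure M2 (B k))"
    using A B by (simp add: M2.emeasure_pair_measure_Times)
  finally show ?thesis by (simp add: prod.distrib)
qed

text \<open>The event \<open>N(t) = m\<close> is not a finite cylinder in the waiting times, so the
  product formula for cylinders does not reach it directly. Cylinders in the second components are
  stable under intersection, hence independence extends to the sigma-algebra they generate.\<close>

lemma prob_pair_sequence_cylinder_inter:
  assumes M1: "prob_space M1" and M2: "prob_space M2" and A: "A \<in> sets M1"
  defines "P \<equiv> \<Pi>\<^sub>M k\<in>(UNIV :: nat set). M1 \<Otimes>\<^sub>M M2"
  defines "G \<equiv> {{\<omega> \<in> space P. \<forall>k<m. snd (\<omega> k) \<in> B k} | m B. \<forall>k::nat. B k \<in> sets M2}"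
  assumes b: "b \<in> sigma_sets (space P) G"
  shows "measure P ({\<omega> \<in> space P. \<forall>k<m. fst (\<omega> k) \<in> A} \<inter> b) = measure M1 A ^ m * measure P b"
proof -
  interpret M1: prob_space M1 by fact
  interpret M2: prob_space M2 by fact
  interpret pair: pair_prob_space M1 M2 ..
  interpret PP: product_prob_space "\<lambda>_ :: nat. M1 \<Otimes>\<^sub>M M2" UNIV ..
  interpret P: prob_space P unfolding P_def by (rule PP.P.prob_space_axioms)
  have cyl: "measure P {\<omega> \<in> space P. \<forall>k<m. fst (\<omega> k) \<in> A k \<and> snd (\<omega> k) \<in> B k}
    = (\<Prod>k<m. measure M1 (A k)) * (\<Prod>k<m. measure M2 (B k))"
    if "\<And>k. A k \<in> sets M1" "\<And>k. B k \<in> sets M2" for A B m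
    using emeasure_pair_sequence_cylinder[OF M1 M2 that, of m, folded P_def]
    unfolding P.emeasure_eq_measure M1.emeasure_eq_measure M2.emeasure_eq_measure
    by (simp add: prod_ennreal ennreal_mult[symmetric] prod_nonneg)
  have space: "fst (\<omega> k) \<in> space M1" "snd (\<omega> k) \<in> space M2" if "\<omega> \<in> space P" for \<omega> k
    using that by (auto simp: P_def space_PiM space_pair_measure PiE_iff mem_Times_iff)
  have meas_cyl: "{\<omega> \<in> space P. \<forall>k<m. fst (\<omega> k) \<in> A k \<and> snd (\<omega> k) \<in> B k} \<in> sets P"
    if [measurable]: "\<And>k. A k \<in> sets M1" "\<And>k. B k \<in> sets M2" for A B m
    unfolding P_def by measurable
  let ?a = "{\<omega> \<in> space P. \<forall>k<m. fst (\<omega> k) \<in> A}"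
  \<comment> \<open>Padding with the whole space brings cylinders of different lengths to a common
    length \<open>n\<close>; \<open>G_eq\<close> below does the same for the second
    components.\<close>
  have a_eq: "?a = {\<omega> \<in> space P. \<forall>k<n. fst (\<omega> k) \<in> (if k < m then A else space M1) \<and> snd (\<omega> k) \<in> space M2}"
    if "m \<le> n" for n
    using that space by auto
  have a_prob: "measure P ?a = measure M1 A ^ m"
    unfolding a_eq[OF order_refl] using A by (subst cyl) (auto simp: M2.prob_space)
  have "P.indep_set {?a} G"
  proof (rule P.indep_setI)
    show "{?a} \<subseteq> P.events"
    proof -
      note [measurable] = A
      have "?a \<in> P.events" unfolding P_def by measurable
      then show ?thesis by blast
    qed
    have G_eq: "{\<omega> \<in> space P. \<forall>k<l. snd (\<omega> k) \<in> B k}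
      = {\<omega> \<in> space P. \<forall>k<n. fst (\<omega> k) \<in> space M1 \<and> snd (\<omega> k) \<in> (if k < l then B k else space M2)}"
      if "l \<le> n" for n l B
      using that space by auto
    show "G \<subseteq> P.events"
    proof
      fix b assume "b \<in> G"
      then obtain l B where b: "b = {\<omega> \<in> space P. \<forall>k<l. snd (\<omega> k) \<in> B k}" and B: "\<And>k. B k \<in> sets M2"
        by (auto simp: G_def)
      show "b \<in> P.events"
        unfolding b G_eq[OF order_refl] using B by (intro meas_cyl) auto
    qed
    fix a b assume "a \<in> {?a}" and "b \<in> G"
    then obtain l B where a: "a = ?a" and b: "b = {\<omega> \<in> space P. \<forall>k<l. snd (\<omega> k) \<in> B k}"
      and B: "\<And>k. B k \<in> sets M2"
      by (auto simp: G_def)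
    define n where "n = max m l"
    have n: "m \<le> n" "l \<le> n" by (auto simp: n_def)
    let ?A = "\<lambda>k. if k < m then A else space M1" and ?B = "\<lambda>k. if k < l then B k else space M2"
    have sets: "?A k \<in> sets M1" "?B k \<in> sets M2" for k using A B by auto
    have "a \<inter> b = {\<omega> \<in> space P. \<forall>k<n. fst (\<omega> k) \<in> ?A k \<and> snd (\<omega> k) \<in> ?B k}"
      unfolding a b a_eq[OF n(1)] G_eq[OF n(2)] using space sets.sets_into_space[OF sets(1)] sets.sets_into_space[OF sets(2)]
      by blast
    then have "measure P (a \<inter> b) = (\<Prod>k<n. measure M1 (?A k)) * (\<Prod>k<n. measure M2 (?B k))"
      using cyl[of ?A ?B n] sets by simp
    moreover have "measure P a = (\<Prod>k<n. measure M1 (?A k))"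
      unfolding a a_eq[OF n(1)] using sets(1) by (subst cyl) (auto simp: M2.prob_space)
    moreover have "measure P b = (\<Prod>k<n. measure M2 (?B k))"
      unfolding b G_eq[OF n(2)] using sets(2) by (subst cyl) (auto simp: M1.prob_space)
    ultimately show "measure P (a \<inter> b) = measure P a * measure P b" by simp
  qed
  moreover have "Int_stable G"
  proof (rule Int_stableI)
    fix b c assume "b \<in> G" "c \<in> G"
    then obtain l B l' B' where b: "b = {\<omega> \<in> space P. \<forall>k<l. snd (\<omega> k) \<in> B k}" "\<And>k. B k \<in> sets M2"
      and c: "c = {\<omega> \<in> space P. \<forall>k<l'. snd (\<omega> k) \<in> B' k}" "\<And>k. B' k \<in> sets M2"
      by (auto simp: G_def)
    let ?B = "\<lambda>k. (if k < l then B k else space M2) \<inter> (if k < l' then B' k else space M2)"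
    have "b \<inter> c = {\<omega> \<in> space P. \<forall>k<max l l'. snd (\<omega> k) \<in> ?B k}"
      unfolding b c using space by (auto split: if_splits)
    moreover have "?B k \<in> sets M2" for k using b c by auto
    ultimately show "b \<inter> c \<in> G"
      unfolding G_def by (intro CollectI exI[of _ "max l l'"] exI[of _ ?B]) simp
  qed
  moreover have "Int_stable {?a}" by (auto simp: Int_stable_def)
  ultimately have "P.indep_set (sigma_sets (space P) {?a}) (sigma_sets (space P) G)"
    by (intro P.indep_set_sigma_sets)
  from P.indep_setD[OF this _ b, of ?a] show ?thesis
    by (simp add: a_prob sigma_sets.Basic)
qed

section \<open>The Poissonized covering process\<close>

context
  fixes p :: "nat pmf" and n :: nat
  assumes n_pos: "0 < n"
begin

section \<open>The sample space and its coordinates\<close>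

definition obj_measure :: "(nat \<times> nat) measure" where
  "obj_measure = measure_pmf p \<Otimes>\<^sub>M measure_pmf (pmf_of_set {0..<n})"

definition wait_measure :: "real measure" where
  "wait_measure = density lborel (exponential_density 1)"

abbreviation (input) P where "P \<equiv> cover_space p n"

lemma P_eq: "P = (\<Pi>\<^sub>M k\<in>UNIV. obj_measure \<Otimes>\<^sub>M wait_measure)"
  by (simp add: cover_space_def coord_measure_def obj_measure_def wait_measure_def)

lemma sets_obj_measure [simp, measurable_cong]: "sets obj_measure = sets (count_space UNIV)"
proof -
  have "sets obj_measure = sets (count_space (UNIV :: nat set) \<Otimes>\<^sub>M count_space (UNIV :: nat set))"
    unfolding obj_measure_def by (intro sets_pair_measure_cong) auto
  also have "count_space (UNIV :: nat set) \<Otimes>\<^sub>M count_space (UNIV :: nat set) = count_space (UNIV \<times> UNIV)"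
    by (rule pair_measure_countable) auto
  finally show ?thesis by simp
qed

lemma sets_wait_measure [simp, measurable_cong]: "sets wait_measure = sets borel"
  by (simp add: wait_measure_def)

lemma space_wait_measure [simp]: "space wait_measure = UNIV"
  by (simp add: wait_measure_def)

lemma space_obj_measure [simp]: "space obj_measure = UNIV"
  using sets_eq_imp_space_eq[OF sets_obj_measure] by simp

lemma space_P [simp]: "space P = UNIV"
  by (simp add: P_eq space_PiM space_pair_measure)

lemma prob_space_obj_measure: "prob_space obj_measure"
proof -
  interpret pair_prob_space "measure_pmf p" "measure_pmf (pmf_of_set {0..<n})" ..
  show ?thesis unfolding obj_measure_def by unfold_locales
qed

lemma prob_space_wait_measure: "prob_space wait_measure"
  unfolding wait_measure_def by (rule prob_space_exponential_density) simp

interpretation O: prob_space obj_measure by (rule prob_space_obj_measure)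
interpretation W: prob_space wait_measure by (rule prob_space_wait_measure)
interpretation OW: pair_prob_space obj_measure wait_measure ..
interpretation PP: product_prob_space "\<lambda>_ :: nat. obj_measure \<Otimes>\<^sub>M wait_measure" UNIV ..
interpretation P: prob_space P unfolding P_eq by (rule PP.P.prob_space_axioms)

lemma measurable_coord [measurable]: "(\<lambda>\<omega>. \<omega> k) \<in> P \<rightarrow>\<^sub>M obj_measure \<Otimes>\<^sub>M wait_measure"
  unfolding P_eq by measurable

lemma measurable_fst_coord [measurable]: "(\<lambda>\<omega>. fst (\<omega> k)) \<in> P \<rightarrow>\<^sub>M count_space UNIV"
  by (rule measurable_compose[OF measurable_coord]) measurable

lemma measurable_snd_coord [measurable]: "(\<lambda>\<omega>. snd (\<omega> k)) \<in> borel_measurable P"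
  by (rule measurable_compose[OF measurable_coord]) measurable

lemma measurable_arrival [measurable]: "(\<lambda>\<omega>. arrival \<omega> k) \<in> borel_measurable P"
  unfolding arrival_def by measurable

lemma measurable_poisson_count [measurable]: "(\<lambda>\<omega>. poisson_count \<omega> t) \<in> P \<rightarrow>\<^sub>M count_space UNIV"
  unfolding poisson_count_def by measurable

lemma distr_coord: "distr P (obj_measure \<Otimes>\<^sub>M wait_measure) (\<lambda>\<omega>. \<omega> k) = obj_measure \<Otimes>\<^sub>M wait_measure"
  unfolding P_eq by (rule PP.PiM_component) simp

section \<open>Laws of the waiting and arrival times\<close>

lemma distributed_wait: "distributed P lborel (\<lambda>\<omega>. snd (\<omega> k)) (exponential_density 1)"
proof -
  have "distr P lborel (\<lambda>\<omega>. snd (\<omega> k)) = density lborel (exponential_density 1)"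
  proof (rule measure_eqI)
    fix A assume "A \<in> sets (distr P lborel (\<lambda>\<omega>. snd (\<omega> k)))"
    then have A: "A \<in> sets borel" by simp
    have "emeasure (distr P lborel (\<lambda>\<omega>. snd (\<omega> k))) A = emeasure P {\<omega> \<in> space P. \<omega> k \<in> UNIV \<times> A}"
      using A by (subst emeasure_distr) (auto simp: vimage_def mem_Times_iff)
    also have "\<dots> = emeasure (obj_measure \<Otimes>\<^sub>M wait_measure) (UNIV \<times> A)"
      unfolding P_eq using A by (intro PP.emeasure_PiM_Collect_single) auto
    also have "\<dots> = emeasure wait_measure A"
      using A O.emeasure_space_1 by (subst W.emeasure_pair_measure_Times) auto
    finally show "emeasure (distr P lborel (\<lambda>\<omega>. snd (\<omega> k))) A = emeasure (density lborel (exponential_density 1)) A"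
      by (simp add: wait_measure_def)
  qed simp
  then show ?thesis
    by (simp add: distributed_def)
qed

lemma indep_waits: "P.indep_vars (\<lambda>_. borel) (\<lambda>k \<omega>. snd (\<omega> k)) UNIV"
proof -
  have "P.indep_vars (\<lambda>_. obj_measure \<Otimes>\<^sub>M wait_measure) (\<lambda>k \<omega>. \<omega> k) UNIV"
  proof (subst P.indep_vars_iff_distr_eq_PiM')
    show "distr P (\<Pi>\<^sub>M i\<in>UNIV. obj_measure \<Otimes>\<^sub>M wait_measure) (\<lambda>x. \<lambda>i\<in>UNIV. x i)
        = (\<Pi>\<^sub>M i\<in>UNIV. distr P (obj_measure \<Otimes>\<^sub>M wait_measure) (\<lambda>\<omega>. \<omega> i))"
      unfolding distr_coord P_eq[symmetric] by (simp add: restrict_def)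
  qed auto
  then show ?thesis
    by (rule P.indep_vars_compose2) measurable
qed

text \<open>Numbering starts at 0, so \<open>arrival \<omega> k\<close> sums \<open>k + 1\<close>
  independent exponential times and has the Erlang law of index \<open>k\<close>.\<close>

lemma prob_arrival_le:
  assumes "0 \<le> t"
  shows "P.prob {\<omega>. arrival \<omega> k \<le> t} = 1 - (\<Sum>j\<le>k. t ^ j * exp (- t) / fact j)"
proof -
  have "P.indep_vars (\<lambda>_. borel) (\<lambda>k \<omega>. snd (\<omega> k)) {..k}"
    by (rule P.indep_vars_subset[OF indep_waits]) auto
  then have "distributed P lborel (\<lambda>\<omega>. \<Sum>i\<in>{..k}. snd (\<omega> i)) (erlang_density (card {..k} - 1) 1)"
    by (intro P.exponential_distributed_sum distributed_wait) auto
  then have "P.prob {\<omega> \<in> space P. arrival \<omega> k \<le> t} = erlang_CDF k 1 t"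
    unfolding arrival_def using assms by (intro P.erlang_distributed_le) auto
  then show ?thesis using assms by (simp add: erlang_CDF_def)
qed

lemma prob_arrival_le_tendsto:
  assumes "0 \<le> t"
  shows "(\<lambda>k. P.prob {\<omega>. arrival \<omega> k \<le> t}) \<longlonglongrightarrow> 0"
proof -
  have "(\<lambda>j. t ^ j * exp (- t) / fact j) sums (exp t * exp (- t))"
    using sums_mult2[OF exp_converges[of t], of "exp (- t)"] by (simp add: field_simps)
  then have "(\<lambda>k. 1 - (\<Sum>j\<le>k. t ^ j * exp (- t) / fact j)) \<longlonglongrightarrow> 1 - 1"
    unfolding sums_def_le by (intro tendsto_intros) (simp add: exp_minus)
  then show ?thesis using assms by (simp add: prob_arrival_le)
qed

lemma AE_wait_nonneg: "AE \<omega> in P. \<forall>k. 0 \<le> snd (\<omega> k)"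
proof (subst AE_all_countable, intro allI)
  fix k
  have "AE x in distr P lborel (\<lambda>\<omega>. snd (\<omega> k)). 0 \<le> x"
    unfolding distributed_distr_eq_density[OF distributed_wait]
    by (subst AE_density) (auto simp: exponential_density_def)
  then show "AE \<omega> in P. 0 \<le> snd (\<omega> k)"
    by (subst (asm) AE_distr_iff) auto
qed

text \<open>\<open>poisson_count\<close> uses \<open>card\<close>, which is 0 on infinite sets, so
  accumulating arrivals must be excluded. All arrivals lie below \<open>t\<close> with probability
  at most that of \<open>arrival \<omega> k \<le> t\<close>, for each \<open>k\<close>, and this
  tends to 0.\<close>

lemma AE_arrival_unbounded: "AE \<omega> in P. \<forall>t. \<exists>k. t < arrival \<omega> k"
proof -
  have null: "P.prob {\<omega>. \<forall>k. arrival \<omega> k \<le> real t} = 0" for t :: nat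
  proof -
    have "P.prob {\<omega>. \<forall>k. arrival \<omega> k \<le> real t} \<le> P.prob {\<omega>. arrival \<omega> k \<le> real t}" for k
    proof (rule P.finite_measure_mono)
      have "{\<omega> \<in> space P. arrival \<omega> k \<le> real t} \<in> P.events" by measurable
      then show "{\<omega>. arrival \<omega> k \<le> real t} \<in> P.events" by simp
    qed auto
    then have "P.prob {\<omega>. \<forall>k. arrival \<omega> k \<le> real t} \<le> 0"
      using prob_arrival_le_tendsto[of "real t"] by (intro LIMSEQ_le_const[where X = "\<lambda>k. P.prob {\<omega>. arrival \<omega> k \<le> real t}"]) auto
    then show ?thesis by (simp add: measure_le_0_iff)
  qed
  have "AE \<omega> in P. \<not> (\<forall>k. arrival \<omega> k \<le> real t)" for t :: nat
  proof (rule AE_I)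
    have "{\<omega> \<in> space P. \<forall>k. arrival \<omega> k \<le> real t} \<in> P.events" by measurable
    then show "{\<omega>. \<forall>k. arrival \<omega> k \<le> real t} \<in> P.events" by simp
    show "emeasure P {\<omega>. \<forall>k. arrival \<omega> k \<le> real t} = 0" by (simp add: P.emeasure_eq_measure null)
  qed auto
  then have "AE \<omega> in P. \<forall>t::nat. \<not> (\<forall>k. arrival \<omega> k \<le> real t)"
    by (subst AE_all_countable) auto
  then show ?thesis
  proof eventually_elim
    case (elim \<omega>)
    show ?case
    proof
      fix t :: real
      obtain m :: nat where "t \<le> real m" using real_arch_simple by blast
      moreover obtain k where "real m < arrival \<omega> k" using elim by (auto simp: not_le)
      ultimately show "\<exists>k. t < arrival \<omega> k" by (intro exI[of _ k]) simp
    qed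
  qed
qed


text \<open>Given the radius \<open>r\<close>, the uniform left end produces a hit with probability
  \<open>hit_count n A r / n\<close>.\<close>

lemma prob_obj_misses:
  "O.prob {ru. arc n (snd ru) (fst ru) \<inter> A = {}}
    = 1 - measure_pmf.expectation p (\<lambda>r. real (hit_count n A r)) / real n"
proof -
  let ?H = "{ru. arc n (snd ru) (fst ru) \<inter> A \<noteq> {}}"
  have "emeasure obj_measure ?H
      = (\<integral>\<^sup>+ r. emeasure (measure_pmf (pmf_of_set {0..<n})) (Pair r -` ?H) \<partial>measure_pmf p)"
  proof -
    have "?H \<in> sets (measure_pmf p \<Otimes>\<^sub>M measure_pmf (pmf_of_set {0..<n}))"
      using sets_obj_measure unfolding obj_measure_def by simp
    then show ?thesis
      unfolding obj_measure_def by (rule measure_pmf.emeasure_pair_measure_alt)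
  qed
  also have "\<dots> = (\<integral>\<^sup>+ r. ennreal (real (hit_count n A r) / real n) \<partial>measure_pmf p)"
  proof (rule nn_integral_cong)
    fix r
    have "{0..<n} \<inter> Pair r -` ?H = {u. u < n \<and> arc n u r \<inter> A \<noteq> {}}" by auto
    then show "emeasure (measure_pmf (pmf_of_set {0..<n})) (Pair r -` ?H) = ennreal (real (hit_count n A r) / real n)"
      using n_pos by (simp add: emeasure_pmf_of_set hit_count_def)
  qed
  also have "\<dots> = ennreal (measure_pmf.expectation p (\<lambda>r. real (hit_count n A r) / real n))"
  proof (rule nn_integral_eq_integral)
    have "hit_count n A r \<le> n" for r
      unfolding hit_count_def using card_mono[of "{..<n}" "{u. u < n \<and> arc n u r \<inter> A \<noteq> {}}"] by auto
    then show "integrable (measure_pmf p) (\<lambda>r. real (hit_count n A r) / real n)"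
      by (intro measure_pmf.integrable_const_bound[where B = 1]) (auto simp: divide_le_eq_1)
  qed simp
  finally have "O.prob ?H = measure_pmf.expectation p (\<lambda>r. real (hit_count n A r)) / real n"
    by (simp add: O.emeasure_eq_measure)
  moreover have "{ru. arc n (snd ru) (fst ru) \<inter> A = {}} = space obj_measure - ?H"
    by auto
  then have "O.prob {ru. arc n (snd ru) (fst ru) \<inter> A = {}} = 1 - O.prob ?H"
    using O.prob_compl[of ?H] by simp
  ultimately show ?thesis by simp
qed

text \<open>The almost sure event on which the indices of arrivals up to \<open>t\<close> form a
  finite initial segment, so that \<open>poisson_count\<close> really counts.\<close>

definition regular :: "sample \<Rightarrow> bool" where
  "regular \<omega> \<longleftrightarrow> (\<forall>k. 0 \<le> snd (\<omega> k)) \<and> (\<forall>t. \<exists>k. t < arrival \<omega> k)"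

lemma AE_regular: "AE \<omega> in P. regular \<omega>"
  using AE_wait_nonneg AE_arrival_unbounded by eventually_elim (simp add: regular_def)

lemma less_poisson_count_iff:
  assumes "regular \<omega>"
  shows "k < poisson_count \<omega> t \<longleftrightarrow> arrival \<omega> k \<le> t"
proof -
  have mono: "arrival \<omega> i \<le> arrival \<omega> j" if "i \<le> j" for i j
    unfolding arrival_def using that assms by (intro sum_mono2) (auto simp: regular_def)
  obtain m where m: "t < arrival \<omega> m" "\<And>k. k < m \<Longrightarrow> \<not> t < arrival \<omega> k"
    using assms exists_least_iff[of "\<lambda>k. t < arrival \<omega> k"] by (auto simp: regular_def)
  have "{k. arrival \<omega> k \<le> t} = {..<m}"
  proof (intro set_eqI)
    fix k show "k \<in> {k. arrival \<omega> k \<le> t} \<longleftrightarrow> k \<in> {..<m}"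
      using m mono[of m k] by (cases "k < m") (auto simp: not_less)
  qed
  then show ?thesis by (auto simp: poisson_count_def)
qed

lemma poisson_count_mono:
  assumes "regular \<omega>" "s \<le> t"
  shows "poisson_count \<omega> s \<le> poisson_count \<omega> t"
  using less_poisson_count_iff[OF assms(1)] assms(2) by (meson leI le_less_trans less_irrefl order_trans)

lemma poisson_count_event [measurable]: "{\<omega>. poisson_count \<omega> t = m} \<in> sets P"
  using measurable_sets[OF measurable_poisson_count, of "{m}" t] by (simp add: vimage_def)

text \<open>\<open>N(t) > k\<close> means that arrival \<open>k\<close> has occurred by
  \<open>t\<close>; the Poisson weights are differences of consecutive Erlang probabilities.\<close>

lemma prob_poisson_count:
  assumes "0 \<le> t"
  shows "P.prob {\<omega>. poisson_count \<omega> t = m} = t ^ m * exp (- t) / fact m"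
proof -
  have sets: "{\<omega>. k < poisson_count \<omega> t} \<in> sets P" for k
    using measurable_sets[OF measurable_poisson_count, of "{k<..}" t] by (simp add: vimage_def)
  have gt: "P.prob {\<omega>. k < poisson_count \<omega> t} = 1 - (\<Sum>j\<le>k. t ^ j * exp (- t) / fact j)" for k
  proof -
    have "P.prob {\<omega>. k < poisson_count \<omega> t} = P.prob {\<omega>. arrival \<omega> k \<le> t}"
    proof (rule measure_eq_AE)
      show "AE \<omega> in P. \<omega> \<in> {\<omega>. k < poisson_count \<omega> t} \<longleftrightarrow> \<omega> \<in> {\<omega>. arrival \<omega> k \<le> t}"
        using AE_regular by eventually_elim (simp add: less_poisson_count_iff)
      have "{\<omega> \<in> space P. arrival \<omega> k \<le> t} \<in> P.events" by measurable
      then show "{\<omega>. arrival \<omega> k \<le> t} \<in> P.events" by simp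
    qed (rule sets)
    then show ?thesis using prob_arrival_le[OF assms] by simp
  qed
  show ?thesis
  proof (cases m)
    case 0
    have "{\<omega>. poisson_count \<omega> t = 0} = space P - {\<omega>. 0 < poisson_count \<omega> t}" by auto
    then show ?thesis using P.prob_compl[OF sets[of 0]] gt[of 0] 0 by simp
  next
    case (Suc k)
    have "{\<omega>. poisson_count \<omega> t = Suc k} = {\<omega>. k < poisson_count \<omega> t} - {\<omega>. Suc k < poisson_count \<omega> t}"
      by auto
    moreover have "{\<omega>. Suc k < poisson_count \<omega> t} \<subseteq> {\<omega>. k < poisson_count \<omega> t}" by auto
    ultimately have "P.prob {\<omega>. poisson_count \<omega> t = Suc k}
        = P.prob {\<omega>. k < poisson_count \<omega> t} - P.prob {\<omega>. Suc k < poisson_count \<omega> t}"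
      using P.finite_measure_Diff[OF sets[of k] sets[of "Suc k"]] by (simp only:)
    then show ?thesis using gt[of k] gt[of "Suc k"] Suc by simp
  qed
qed

text \<open>Measurability of the count is established again over the smaller sigma-algebra of the
  waiting times alone; this is what makes the event independent of the objects.\<close>

lemma poisson_count_event_sigma:
  "{\<omega>. poisson_count \<omega> t = m} \<in> sigma_sets (space P)
    {{\<omega> \<in> space P. \<forall>k<m. snd (\<omega> k) \<in> B k} | m B. \<forall>k::nat. B k \<in> sets wait_measure}"
  (is "_ \<in> sigma_sets _ ?G")
proof -
  define S where "S = sigma (space P) ?G"
  have "?G \<subseteq> Pow (space P)" by auto
  then have sets_S: "sets S = sigma_sets (space P) ?G" and [simp]: "space S = UNIV"
    unfolding S_def by (simp_all only: sets_measure_of space_measure_of space_P)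
  have [measurable]: "(\<lambda>\<omega>. snd (\<omega> k)) \<in> borel_measurable S" for k
  proof (rule measurableI)
    fix C :: "real set" assume "C \<in> sets borel"
    let ?B = "\<lambda>j. if j = k then C else UNIV"
    have "(\<lambda>\<omega>. snd (\<omega> k)) -` C \<inter> space S = {\<omega> \<in> space P. \<forall>j<Suc k. snd (\<omega> j) \<in> ?B j}"
      by auto
    also have "\<dots> \<in> ?G"
      using \<open>C \<in> sets borel\<close> by (intro CollectI exI[of _ "Suc k"] exI[of _ ?B]) simp
    finally show "(\<lambda>\<omega>. snd (\<omega> k)) -` C \<inter> space S \<in> sets S"
      unfolding sets_S by (rule sigma_sets.Basic)
  qed simp
  have "(\<lambda>\<omega>. poisson_count \<omega> t) \<in> S \<rightarrow>\<^sub>M count_space UNIV"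
    unfolding poisson_count_def arrival_def by measurable
  from measurable_sets[OF this, of "{m}"] show ?thesis
    by (simp add: sets_S vimage_def)
qed

lemma covered_misses_iff:
  "covered n \<omega> m \<inter> A = {} \<longleftrightarrow> (\<forall>k<m. fst (\<omega> k) \<in> {ru. arc n (snd ru) (fst ru) \<inter> A = {}})"
  by (auto simp: covered_def obj_def)

lemma covered_misses_event [measurable]: "{\<omega>. covered n \<omega> m \<inter> A = {}} \<in> sets P"
proof -
  have "{\<omega> \<in> space P. \<forall>k<m. fst (\<omega> k) \<in> {ru. arc n (snd ru) (fst ru) \<inter> A = {}}} \<in> sets P"
    by measurable
  then show ?thesis by (simp add: covered_misses_iff)
qed

lemma cover_proc_misses_eq_UN:
  "{\<omega>. cover_proc n \<omega> t \<inter> A = {}} = (\<Union>m. {\<omega>. covered n \<omega> m \<inter> A = {}} \<inter> {\<omega>. poisson_count \<omega> t = m})"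
  by (auto simp: cover_proc_def)

lemma cover_proc_misses_event [measurable]: "{\<omega>. cover_proc n \<omega> t \<inter> A = {}} \<in> sets P"
  unfolding cover_proc_misses_eq_UN by measurable

text \<open>Given \<open>N(t) = m\<close>, all objects miss \<open>A\<close> with probability
  \<open>q ^ m\<close>; averaging over the Poisson law gives \<open>exp (- t (1 - q))\<close>, and
  \<open>1 - q\<close> is the mean hit count over \<open>n\<close>.\<close>

lemma prob_cover_proc_misses:
  assumes "0 \<le> t"
  shows "P.prob {\<omega>. cover_proc n \<omega> t \<inter> A = {}}
    = exp (- (t / real n) * measure_pmf.expectation p (\<lambda>r. real (hit_count n A r)))"
proof -
  let ?H = "{ru. arc n (snd ru) (fst ru) \<inter> A = {}}"
  define q where "q = O.prob ?H"
  let ?E = "\<lambda>m. {\<omega>. covered n \<omega> m \<inter> A = {}} \<inter> {\<omega>. poisson_count \<omega> t = m}"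
  have "P.prob (?E m) = q ^ m * P.prob {\<omega>. poisson_count \<omega> t = m}" for m
  proof -
    have "?E m = {\<omega> \<in> space P. \<forall>k<m. fst (\<omega> k) \<in> ?H} \<inter> {\<omega>. poisson_count \<omega> t = m}"
      by (simp add: covered_misses_iff)
    moreover have "P.prob ({\<omega> \<in> space P. \<forall>k<m. fst (\<omega> k) \<in> ?H} \<inter> {\<omega>. poisson_count \<omega> t = m})
        = q ^ m * P.prob {\<omega>. poisson_count \<omega> t = m}"
      using prob_pair_sequence_cylinder_inter[OF prob_space_obj_measure prob_space_wait_measure, folded P_eq,
          OF _ poisson_count_event_sigma, of ?H m t m] by (simp add: q_def)
    ultimately show ?thesis by simp
  qed
  moreover have "(\<lambda>m. P.prob (?E m)) sums P.prob (\<Union>m. ?E m)"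
    by (rule P.finite_measure_UNION) (auto simp: disjoint_family_on_def)
  ultimately have "(\<lambda>m. q ^ m * (t ^ m * exp (- t) / fact m)) sums P.prob {\<omega>. cover_proc n \<omega> t \<inter> A = {}}"
    by (simp add: prob_poisson_count[OF assms] cover_proc_misses_eq_UN)
  moreover have "(\<lambda>m. q ^ m * (t ^ m * exp (- t) / fact m)) sums (exp (q * t) * exp (- t))"
    using sums_mult2[OF exp_converges[of "q * t"], of "exp (- t)"] by (simp add: field_simps power_mult_distrib)
  ultimately have "P.prob {\<omega>. cover_proc n \<omega> t \<inter> A = {}} = exp (q * t) * exp (- t)"
    by (rule sums_unique2)
  also have "\<dots> = exp (- (t * (1 - q)))" by (simp add: exp_add[symmetric] algebra_simps)
  finally show ?thesis by (simp add: q_def prob_obj_misses)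
qed

lemma covered_subset: "covered n \<omega> m \<subseteq> {0..<n}"
  using n_pos by (auto simp: covered_def obj_def arc_def)

lemma covered_mono: "m \<le> m' \<Longrightarrow> covered n \<omega> m \<subseteq> covered n \<omega> m'"
  unfolding covered_def by (intro UN_mono) auto

lemma covered_full_iff: "covered n \<omega> m = {0..<n} \<longleftrightarrow> (\<forall>v<n. covered n \<omega> m \<inter> {v} \<noteq> {})"
  using covered_subset[of \<omega> m] by auto

lemma cover_proc_full_iff: "cover_proc n \<omega> t = {0..<n} \<longleftrightarrow> (\<forall>v<n. cover_proc n \<omega> t \<inter> {v} \<noteq> {})"
  unfolding cover_proc_def by (rule covered_full_iff)

lemma pred_covered_full [measurable]: "Measurable.pred P (\<lambda>\<omega>. covered n \<omega> m = {0..<n})"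
proof -
  have [measurable]: "Measurable.pred P (\<lambda>\<omega>. covered n \<omega> m \<inter> A = {})" for A
    using covered_misses_event[of m A] by (simp add: pred_def)
  show ?thesis unfolding covered_full_iff by measurable
qed

text \<open>The time may be random because measurability of the cover time evaluates the process at
  arrival times.\<close>

lemma pred_cover_proc_full [measurable]:
  assumes T: "T \<in> borel_measurable P"
  shows "Measurable.pred P (\<lambda>\<omega>. cover_proc n \<omega> (T \<omega>) = {0..<n})"
proof -
  have [measurable]: "Measurable.pred P (\<lambda>\<omega>. arrival \<omega> k \<le> T \<omega>)" for k
    unfolding pred_def by (rule borel_measurable_le[OF measurable_arrival T])
  have [measurable]: "(\<lambda>\<omega>. poisson_count \<omega> (T \<omega>)) \<in> P \<rightarrow>\<^sub>M count_space UNIV"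
    unfolding poisson_count_def by measurable
  have "Measurable.pred P (\<lambda>\<omega>. \<exists>m. poisson_count \<omega> (T \<omega>) = m \<and> covered n \<omega> m = {0..<n})"
    by measurable
  then show ?thesis by (simp add: cover_proc_def)
qed

text \<open>Expansion of the product, over \<open>v\<close> in \<open>S\<close>, of 1 minus the
  indicator that \<open>v\<close> is missing from \<open>X\<close>.\<close>

lemma indicator_inclusion_exclusion:
  assumes "finite S" "X \<subseteq> S"
  shows "(if X = S then 1 else 0 :: real) = (\<Sum>A\<in>Pow S. (-1) ^ card A * (if X \<inter> A = {} then 1 else 0))"
proof -
  have "(if X = S then 1 else 0 :: real) = (\<Prod>v\<in>S. 1 - (if v \<in> X then 0 else 1))"
    using assms by (auto intro: prod_zero)
  also have "\<dots> = (\<Sum>A\<in>Pow S. (-1) ^ card A * (\<Prod>v\<in>A. if v \<in> X then 0 else 1))"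
    by (subst prod_diff_conv_sum[OF assms(1)]) simp
  also have "\<dots> = (\<Sum>A\<in>Pow S. (-1) ^ card A * (if X \<inter> A = {} then 1 else 0))"
  proof (intro sum.cong refl arg_cong2[where f = "(*)"])
    fix A assume "A \<in> Pow S"
    then have "finite A" using assms(1) by (auto intro: finite_subset)
    then show "(\<Prod>v\<in>A. if v \<in> X then 0 else 1) = (if X \<inter> A = {} then 1 else 0 :: real)"
      by (cases "X \<inter> A = {}") (auto intro!: prod_zero prod.neutral)
  qed
  finally show ?thesis .
qed

lemma prob_cover_proc_full:
  assumes "0 \<le> t"
  shows "P.prob {\<omega>. cover_proc n \<omega> t = {0..<n}}
    = 1 - fps_nth (fps_X * fps_deriv (gap_fps p (t / real n)) * inverse (gap_fps p (t / real n))) n"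
proof -
  have sets: "{\<omega>. cover_proc n \<omega> t = {0..<n}} \<in> sets P"
    using pred_cover_proc_full[of "\<lambda>_. t"] by (simp add: pred_def)
  have "P.prob {\<omega>. cover_proc n \<omega> t = {0..<n}} = P.expectation (indicator {\<omega>. cover_proc n \<omega> t = {0..<n}})"
    using sets by simp
  also have "\<dots> = P.expectation (\<lambda>\<omega>. \<Sum>A\<in>Pow {..<n}. (-1) ^ card A * indicator {\<omega>. cover_proc n \<omega> t \<inter> A = {}} \<omega>)"
  proof (rule Bochner_Integration.integral_cong[OF refl])
    fix \<omega>
    have "cover_proc n \<omega> t \<subseteq> {..<n}"
      using covered_subset by (simp add: cover_proc_def lessThan_atLeast0)
    from indicator_inclusion_exclusion[OF finite_lessThan this]
    show "indicator {\<omega>. cover_proc n \<omega> t = {0..<n}} \<omega>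
        = (\<Sum>A\<in>Pow {..<n}. (-1) ^ card A * (indicator {\<omega>. cover_proc n \<omega> t \<inter> A = {}} \<omega> :: real))"
      by (simp only: indicator_def of_bool_def mem_Collect_eq lessThan_atLeast0)
  qed
  also have "\<dots> = (\<Sum>A\<in>Pow {..<n}. (-1) ^ card A * P.prob {\<omega>. cover_proc n \<omega> t \<inter> A = {}})"
    by (subst Bochner_Integration.integral_sum)
      (auto intro!: integrable_mult_right integrable_real_indicator cover_proc_misses_event
        simp: P.emeasure_eq_measure)
  also have "\<dots> = 1 - fps_nth (fps_X * fps_deriv (gap_fps p (t / real n)) * inverse (gap_fps p (t / real n))) n"
    by (simp only: prob_cover_proc_misses[OF assms] inclusion_exclusion_hit_count)
  finally show ?thesis .
qed


subsection \<open>The cover time\<close>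

text \<open>The process changes only at arrivals, so the last one up to \<open>t\<close> already
  sees full cover, and the infimum over times reduces to a countable family. Measurability requires
  this for every sample: a non-zero count forces \<open>?K\<close> to be finite and non-empty, and
  \<open>max 0\<close> guards against negative arrival times.\<close>

lemma cover_proc_full_at_arrival:
  assumes "0 \<le> t" "cover_proc n \<omega> t = {0..<n}"
  shows "\<exists>k. max 0 (arrival \<omega> k) \<le> t \<and> cover_proc n \<omega> (max 0 (arrival \<omega> k)) = {0..<n}"
proof -
  let ?K = "{k. arrival \<omega> k \<le> t}"
  have "poisson_count \<omega> t \<noteq> 0"
    using assms(2) n_pos by (auto simp: cover_proc_def covered_def)
  then have K: "finite ?K" "?K \<noteq> {}"
    unfolding poisson_count_def by (simp_all add: card_eq_0_iff)
  have "Max (arrival \<omega> ` ?K) \<in> arrival \<omega> ` ?K" using K by (intro Max_in) auto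
  then obtain k where k: "arrival \<omega> k \<le> t" "arrival \<omega> k = Max (arrival \<omega> ` ?K)"
    by auto
  have "arrival \<omega> j \<le> arrival \<omega> k" if "arrival \<omega> j \<le> t" for j
    unfolding k(2) using K(1) that by (intro Max_ge) auto
  then have "{j. arrival \<omega> j \<le> max 0 (arrival \<omega> k)} = ?K"
    using k(1) assms(1) by fastforce
  then have "cover_proc n \<omega> (max 0 (arrival \<omega> k)) = {0..<n}"
    using assms(2) by (simp add: cover_proc_def poisson_count_def)
  then show ?thesis using k(1) assms(1) by (intro exI[of _ k]) simp
qed

text \<open>Samples that are never covered have cover time \<open>Inf {}\<close>, an unspecified real, and samples whose
  arrivals accumulate have poisson counts 0 at large times; both must be measurable even though they
  form null sets.\<close>

lemma measurable_cover_time [measurable]: "cover_time n \<in> borel_measurable P"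
proof -
  let ?s = "\<lambda>\<omega> k. max 0 (arrival \<omega> k)"
  let ?full = "\<lambda>\<omega> k. cover_proc n \<omega> (?s \<omega> k) = {0..<n}"
  have [measurable]: "Measurable.pred P (\<lambda>\<omega>. ?full \<omega> k)" for k
    by (rule pred_cover_proc_full) measurable
  have less_iff: "cover_time n \<omega> < y \<longleftrightarrow>
      (\<exists>k. ?full \<omega> k \<and> ?s \<omega> k < y) \<or> ((\<forall>k. \<not> ?full \<omega> k) \<and> Inf {} < y)" for \<omega> y
  proof -
    let ?S = "{t. 0 \<le> t \<and> cover_proc n \<omega> t = {0..<n}}"
    have S_empty: "?S = {}" if "\<forall>k. \<not> ?full \<omega> k"
      using that cover_proc_full_at_arrival[of _ \<omega>] by blast
    show ?thesis
    proof (cases "\<exists>k. ?full \<omega> k")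
      case True
      then obtain k where "?s \<omega> k \<in> ?S" by auto
      then have "?S \<noteq> {}" by blast
      moreover have "bdd_below ?S" by (rule bdd_belowI[of _ 0]) auto
      ultimately have "cover_time n \<omega> < y \<longleftrightarrow> (\<exists>t\<in>?S. t < y)"
        unfolding cover_time_def by (rule cInf_less_iff)
      also have "\<dots> \<longleftrightarrow> (\<exists>k. ?full \<omega> k \<and> ?s \<omega> k < y)"
      proof
        assume "\<exists>t\<in>?S. t < y"
        then obtain t where "0 \<le> t" "cover_proc n \<omega> t = {0..<n}" "t < y" by blast
        then show "\<exists>k. ?full \<omega> k \<and> ?s \<omega> k < y"
          using cover_proc_full_at_arrival[of t \<omega>] by (meson le_less_trans)
      next
        assume "\<exists>k. ?full \<omega> k \<and> ?s \<omega> k < y"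
        then obtain k where "?full \<omega> k" "?s \<omega> k < y" by blast
        then show "\<exists>t\<in>?S. t < y" by (intro bexI[of _ "?s \<omega> k"]) simp_all
      qed
      finally show ?thesis using True by blast
    next
      case False
      then have "cover_time n \<omega> = Inf {}"
        unfolding cover_time_def by (intro arg_cong[where f = Inf] S_empty) blast
      then show ?thesis using False by simp
    qed
  qed
  show ?thesis
    unfolding borel_measurable_iff_less less_iff by (intro allI) measurable
qed

text \<open>Radii are at least 1, so the mean hit count of a site is at least 1 and the site is
  still missed at time \<open>t\<close> with probability at most \<open>exp (- t / n)\<close>. Hence
  the infimum in \<open>cover_time\<close> is almost surely over a non-empty set.\<close>

lemma AE_cover_proc_full:
  assumes p: "set_pmf p \<subseteq> {1..}"
  shows "AE \<omega> in P. \<exists>t\<ge>0. cover_proc n \<omega> t = {0..<n}"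
proof -
  have hit_ge: "1 \<le> measure_pmf.expectation p (\<lambda>r. real (hit_count n {v} r))" if "v < n" for v
  proof -
    have "lin_count v v {v} r = 0" for r by (auto simp: lin_count_def)
    then have hit: "hit_count n {v} r = min r n" for r
      using hit_count_chain[of "{v}" v v n r] that by simp
    have "integrable (measure_pmf p) (\<lambda>r. real (hit_count n {v} r))"
      by (intro measure_pmf.integrable_const_bound[where B = "real n"]) (auto simp: hit)
    moreover have "AE r in measure_pmf p. 1 \<le> real (hit_count n {v} r)"
      using p n_pos by (auto simp: AE_measure_pmf_iff hit)
    ultimately have "measure_pmf.expectation p (\<lambda>_. 1 :: real) \<le> measure_pmf.expectation p (\<lambda>r. real (hit_count n {v} r))"
      by (intro integral_mono_AE) auto
    then show ?thesis by simp
  qed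
  have covers: "AE \<omega> in P. \<exists>t::nat. cover_proc n \<omega> (real t) \<inter> {v} \<noteq> {}" if "v < n" for v
  proof -
    let ?N = "\<Inter>t::nat. {\<omega>. cover_proc n \<omega> (real t) \<inter> {v} = {}}"
    have N: "?N \<in> sets P" by measurable
    have "P.prob ?N \<le> exp (- (real t / real n))" for t :: nat
    proof -
      have "P.prob ?N \<le> P.prob {\<omega>. cover_proc n \<omega> (real t) \<inter> {v} = {}}"
        by (intro P.finite_measure_mono cover_proc_misses_event) auto
      also have "\<dots> \<le> exp (- (real t / real n))"
        unfolding prob_cover_proc_misses[OF of_nat_0_le_iff]
        using mult_left_mono[OF hit_ge[OF that], of "real t / real n"] by simp
      finally show ?thesis .
    qed
    moreover have "(\<lambda>t::nat. exp (- (real t / real n))) \<longlonglongrightarrow> 0"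
      using n_pos by real_asymp
    ultimately have "P.prob ?N \<le> 0"
      by (intro LIMSEQ_le_const[where X = "\<lambda>t::nat. exp (- (real t / real n))"]) auto
    then have "emeasure P ?N = 0"
      by (simp add: P.emeasure_eq_measure measure_le_0_iff)
    then show ?thesis
      using N by (intro AE_I[where N = ?N]) auto
  qed
  have "AE \<omega> in P. \<forall>v\<in>{..<n}. \<exists>t::nat. cover_proc n \<omega> (real t) \<inter> {v} \<noteq> {}"
    by (rule AE_finite_allI) (use covers in auto)
  with AE_regular show ?thesis
  proof eventually_elim
    case (elim \<omega>)
    then obtain T :: "nat \<Rightarrow> nat" where T: "\<And>v. v < n \<Longrightarrow> cover_proc n \<omega> (real (T v)) \<inter> {v} \<noteq> {}"
      by (metis lessThan_iff)
    \<comment> \<open>The sum is a convenient common upper bound of the finitely many times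
      \<open>T v\<close>.\<close>
    let ?t = "real (\<Sum>v<n. T v)"
    have "cover_proc n \<omega> ?t \<inter> {v} \<noteq> {}" if "v < n" for v
    proof -
      have "T v \<le> (\<Sum>v<n. T v)" using that by (intro member_le_sum) auto
      then have "poisson_count \<omega> (real (T v)) \<le> poisson_count \<omega> ?t"
        by (intro poisson_count_mono elim) linarith
      then show ?thesis
        using T[OF that] covered_mono unfolding cover_proc_def by blast
    qed
    then have "cover_proc n \<omega> ?t = {0..<n}" by (simp only: cover_proc_full_iff) simp
    then show ?case by (intro exI[of _ ?t]) (simp add: sum_nonneg)
  qed
qed

text \<open>The infimum is attained because paths are right-continuous: if the cover is incomplete
  at \<open>t\<close>, it stays so until arrival number \<open>m = N(t)\<close>, which is strictly
  later than \<open>t\<close> by the numbering from 0.\<close>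

lemma cover_time_le_iff:
  assumes reg: "regular \<omega>" and full: "\<exists>s\<ge>0. cover_proc n \<omega> s = {0..<n}" and "0 \<le> t"
  shows "cover_time n \<omega> \<le> t \<longleftrightarrow> cover_proc n \<omega> t = {0..<n}"
proof
  let ?S = "{s. 0 \<le> s \<and> cover_proc n \<omega> s = {0..<n}}"
  show "cover_time n \<omega> \<le> t" if "cover_proc n \<omega> t = {0..<n}"
    unfolding cover_time_def using that \<open>0 \<le> t\<close> by (intro cInf_lower bdd_belowI[of _ 0]) auto
  show "cover_proc n \<omega> t = {0..<n}" if le: "cover_time n \<omega> \<le> t"
  proof (rule ccontr)
    assume not_full: "cover_proc n \<omega> t \<noteq> {0..<n}"
    define m where "m = poisson_count \<omega> t"
    have "t < arrival \<omega> m"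
      using less_poisson_count_iff[OF reg, of m t] by (simp add: m_def not_le)
    have "arrival \<omega> m \<le> s" if "s \<in> ?S" for s
    proof (rule ccontr)
      assume "\<not> arrival \<omega> m \<le> s"
      then have "poisson_count \<omega> s \<le> m"
        using less_poisson_count_iff[OF reg, of m s] by simp
      then have "cover_proc n \<omega> s \<subseteq> cover_proc n \<omega> t"
        using covered_mono unfolding cover_proc_def m_def by blast
      moreover have "cover_proc n \<omega> t \<subseteq> {0..<n}"
        using covered_subset by (simp add: cover_proc_def)
      ultimately show False using that not_full by auto
    qed
    moreover have "?S \<noteq> {}" using full by blast
    ultimately have "arrival \<omega> m \<le> cover_time n \<omega>"
      unfolding cover_time_def by (intro cInf_greatest)
    then show False using le \<open>t < arrival \<omega> m\<close> by simp
  qed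
qed

lemma prob_cover_time_le:
  assumes p: "set_pmf p \<subseteq> {1..}" and "0 \<le> t"
  shows "measure P {\<omega> \<in> space P. cover_time n \<omega> \<le> t}
    = 1 - fps_nth (fps_X * fps_deriv (gap_fps p (t / real n)) * inverse (gap_fps p (t / real n))) n"
proof -
  have "P.prob {\<omega> \<in> space P. cover_time n \<omega> \<le> t} = P.prob {\<omega>. cover_proc n \<omega> t = {0..<n}}"
  proof (rule measure_eq_AE)
    show "AE \<omega> in P. \<omega> \<in> {\<omega> \<in> space P. cover_time n \<omega> \<le> t} \<longleftrightarrow> \<omega> \<in> {\<omega>. cover_proc n \<omega> t = {0..<n}}"
      using AE_regular AE_cover_proc_full[OF p]
      by eventually_elim (simp add: cover_time_le_iff \<open>0 \<le> t\<close>)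
    show "{\<omega> \<in> space P. cover_time n \<omega> \<le> t} \<in> sets P"
      by measurable
    show "{\<omega>. cover_proc n \<omega> t = {0..<n}} \<in> sets P"
      using pred_cover_proc_full[of "\<lambda>_. t"] by (simp add: pred_def)
  qed
  then show ?thesis using prob_cover_proc_full[OF \<open>0 \<le> t\<close>] by simp
qed

end

theorem theoremA:
  fixes pR :: "nat pmf" and \<epsilon> :: real
  assumes "set_pmf pR \<subseteq> {1..}"
    and "\<epsilon> > 0"
    and "integrable (measure_pmf pR) (\<lambda>r. real r powr (1 + \<epsilon>))"
  shows "let \<mu> = measure_pmf.expectation pR real in
    weak_conv
      (\<lambda>n x. measure (cover_space pR n)
         {\<omega> \<in> space (cover_space pR n). \<mu> / real n * cover_time n \<omega> - ln (real n) \<le> x})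
      (\<lambda>x. exp (- exp (- x)))"
  unfolding Let_def weak_conv_def
proof (intro allI impI)
  fix x :: real
  define \<mu> where "\<mu> = measure_pmf.expectation pR real"
  have "\<mu> \<ge> 1" unfolding \<mu>_def by (rule expectation_ge_1[OF assms])
  let ?l = "\<lambda>n::nat. (ln (real n) + x) / \<mu>"
  have "\<forall>\<^sub>F n::nat in sequentially. ln (real n) + x \<ge> 0"
    by real_asymp
  with eventually_gt_at_top[of 0]
  have "\<forall>\<^sub>F n in sequentially.
      1 - fps_nth (fps_X * fps_deriv (gap_fps pR (?l n)) * inverse (gap_fps pR (?l n))) n
      = measure (cover_space pR n)
         {\<omega> \<in> space (cover_space pR n). \<mu> / real n * cover_time n \<omega> - ln (real n) \<le> x}"
  proof eventually_elim
    case (elim n)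
    \<comment> \<open>The time is \<open>t = n * ?l n\<close>, so \<open>t / n\<close> is the
      parameter of \<open>gap_fps\<close>; \<open>ln n + x \<ge> 0\<close>, true for large
      \<open>n\<close>, makes \<open>t\<close> non-negative as the exact formula requires.\<close>
    have "\<mu> / real n * s - ln (real n) \<le> x \<longleftrightarrow> s \<le> real n * ?l n" for s
      using elim \<open>\<mu> \<ge> 1\<close> by (simp add: field_simps)
    then show ?case
      using prob_cover_time_le[OF elim(1) assms(1), of "real n * ?l n"] elim \<open>\<mu> \<ge> 1\<close> by simp
  qed
  then show "(\<lambda>n. measure (cover_space pR n)
         {\<omega> \<in> space (cover_space pR n). measure_pmf.expectation pR real / real n * cover_time n \<omega>
            - ln (real n) \<le> x}) \<longlonglongrightarrow> exp (- exp (- x))"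
    using log_deriv_tendsto[OF assms, of x] unfolding \<mu>_def
    by (rule Lim_transform_eventually[rotated])
qed

end
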